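(* Let $X$ be a median algebra equipped with its intrinsic median topology $\tau_{\mathrm m}$. Let $G$ be a topological group acting separately continuously on $(X,\tau_{\mathrm m})$ by median automorphisms. Then: (1) The median uniformity $\mathcal U_{\mathrm m}$ is $G$-bounded. (2) If, in addition, $X\in(T^m_2)$, then the action extends uniquely to a jointly continuous action $G\times\widehat X\to\widehat X$ on the minimal median compactification (MMC) $\widehat X$. Hence $X\to\widehat X$ is a proper median $G$-compactification. In particular, the original action $G\times X\to X$ is jointly continuous.
   Context: A median algebra is a set $X$ with a ternary operation $m\colon X^3\to X$ that is symmetric in all variables and satisfies $m(a,b,b)=b$ and $m(m(a,x,b),x,c)=m(a,x,m(b,x,c))$. Intervals: $[x,y]=\{z: m(x,y,z)=z\}$. A subalgebra is a chain if it carries a linear order $\le$ for which $m(a,b,c)=b$ whenever $a\le b\le c$. Canonical retraction: $\phi_{u,v}(z)=m(u,z,v)$. Branches: $B^u_v=\{x: m(u,x,v)\neq v\}$. The median uniformity $\mathcal U_{\mathrm m}$ is the covering uniformity with uniform subbase all two-member covers $\{B^u_v,B^v_u\}$, where $[u,v]$ runs over all chain intervals with $u\neq v$: a cover belongs to $\mathcal U_{\mathrm m}$ iff it is refined by a finite common refinement of such covers. Its topology is $\tau_{\mathrm m}$ (possibly non-Hausdorff). $X\in(T^m_2)$ means: for all $x\ne y$ there is a chain interval $[u,v]$, $u\neq v$, with $\{\phi_{u,v}(x),\phi_{u,v}(y)\}=\{u,v\}$; equivalently $\mathcal U_{\mathrm m}$ is Hausdorff. In that case the MMC $\widehat X$ is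 the Hausdorff completion of $(X,\mathcal U_{\mathrm m})$, a compact Hausdorff topological median algebra with the unique continuous extension of $m$. An action is separately continuous if all translations $x\mapsto gx$ and all orbit maps $g\mapsto gx$ are continuous. A uniformity $\mathcal U$ on a $G$-space $X$ is $G$-bounded if for every cover $\alpha\in\mathcal U$ there is a neighborhood $V$ of the identity of $G$ such that the cover $\{Vx: x\in X\}$ refines $\alpha$. A proper median $G$-compactification of $X$ is a $G$-equivariant, median-preserving topological embedding with dense image into a compact Hausdorff topological median algebra on which $G$ acts jointly continuously by median automorphisms. *)

theory Defs
  imports "HOL-Analysis.Analysis" "HOL-Algebra.Group_Action"
begin

section \<open>Median algebras\<close>

locale median_algebra =
  fixes X :: "'a set" and m :: "'a \<Rightarrow> 'a \<Rightarrow> 'a \<Rightarrow> 'a"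
  assumes closed: "\<lbrakk>x \<in> X; y \<in> X; z \<in> X\<rbrakk> \<Longrightarrow> m x y z \<in> X"
    and sym12: "\<lbrakk>x \<in> X; y \<in> X; z \<in> X\<rbrakk> \<Longrightarrow> m x y z = m y x z"
    and sym23: "\<lbrakk>x \<in> X; y \<in> X; z \<in> X\<rbrakk> \<Longrightarrow> m x y z = m x z y"
    and majority: "\<lbrakk>a \<in> X; b \<in> X\<rbrakk> \<Longrightarrow> m a b b = b"
    and assoc: "\<lbrakk>a \<in> X; b \<in> X; c \<in> X; x \<in> X\<rbrakk> \<Longrightarrow> m (m a x b) x c = m a x (m b x c)"

definition median_interval :: "'a set \<Rightarrow> ('a \<Rightarrow> 'a \<Rightarrow> 'a \<Rightarrow> 'a) \<Rightarrow> 'a \<Rightarrow> 'a \<Rightarrow> 'a set"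
  where "median_interval X m x y = {z \<in> X. m x y z = z}"

definition median_subalgebra :: "'a set \<Rightarrow> ('a \<Rightarrow> 'a \<Rightarrow> 'a \<Rightarrow> 'a) \<Rightarrow> 'a set \<Rightarrow> bool"
  where "median_subalgebra X m C \<longleftrightarrow>
    C \<subseteq> X \<and> (\<forall>x\<in>C. \<forall>y\<in>C. \<forall>z\<in>C. m x y z \<in> C)"

definition median_chain :: "'a set \<Rightarrow> ('a \<Rightarrow> 'a \<Rightarrow> 'a \<Rightarrow> 'a) \<Rightarrow> 'a set \<Rightarrow> bool"
  where "median_chain X m C \<longleftrightarrow>
    median_subalgebra X m C \<and>
    (\<exists>r. linear_order_on C r \<and>
      (\<forall>a\<in>C. \<forall>b\<in>C. \<forall>c\<in>C. (a, b) \<in> r \<and> (b, c) \<in> r \<longrightarrow> m a b c = b))"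

definition chain_interval :: "'a set \<Rightarrow> ('a \<Rightarrow> 'a \<Rightarrow> 'a \<Rightarrow> 'a) \<Rightarrow> 'a \<Rightarrow> 'a \<Rightarrow> bool"
  where "chain_interval X m u v \<longleftrightarrow>
    u \<in> X \<and> v \<in> X \<and> median_chain X m (median_interval X m u v)"

definition retraction :: "('a \<Rightarrow> 'a \<Rightarrow> 'a \<Rightarrow> 'a) \<Rightarrow> 'a \<Rightarrow> 'a \<Rightarrow> 'a \<Rightarrow> 'a"
  where "retraction m u v z = m u z v"

text \<open>\<open>branch X m u v\<close> is $B^u_v$.\<close>

definition branch :: "'a set \<Rightarrow> ('a \<Rightarrow> 'a \<Rightarrow> 'a \<Rightarrow> 'a) \<Rightarrow> 'a \<Rightarrow> 'a \<Rightarrow> 'a set"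
  where "branch X m u v = {x \<in> X. m u x v \<noteq> v}"

definition median_T2 :: "'a set \<Rightarrow> ('a \<Rightarrow> 'a \<Rightarrow> 'a \<Rightarrow> 'a) \<Rightarrow> bool"
  where "median_T2 X m \<longleftrightarrow>
    (\<forall>x\<in>X. \<forall>y\<in>X. x \<noteq> y \<longrightarrow>
      (\<exists>u v. chain_interval X m u v \<and> u \<noteq> v \<and>
             {retraction m u v x, retraction m u v y} = {u, v}))"


section \<open>Covering uniformities\<close>

text \<open>A covering uniformity is represented by the set of its uniform covers. The library's
  \<open>uniform_space\<close> is a type class based on entourages, and so does not apply to a uniformity
  on a carrier set that is determined by an algebraic structure.\<close>

definition covers :: "'a set \<Rightarrow> 'a set set set"
  where "covers X = {\<alpha>. \<Union>\<alpha> = X}"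

definition cover_refines :: "'a set set \<Rightarrow> 'a set set \<Rightarrow> bool"
  where "cover_refines \<alpha> \<beta> \<longleftrightarrow> (\<forall>A\<in>\<alpha>. \<exists>B\<in>\<beta>. A \<subseteq> B)"

text \<open>The common refinement $\alpha_1 \wedge \dots \wedge \alpha_n$ of a family of covers consists
  of all intersections $A_1 \cap \dots \cap A_n$ with $A_i \in \alpha_i$; for the empty family it
  is the trivial cover \<open>{X}\<close>.\<close>

definition cover_meet :: "'a set \<Rightarrow> 'a set set set \<Rightarrow> 'a set set"
  where "cover_meet X \<C> = {X \<inter> (\<Inter>\<alpha>\<in>\<C>. f \<alpha>) | f. \<forall>\<alpha>\<in>\<C>. f \<alpha> \<in> \<alpha>}"

definition generated_uniformity :: "'a set \<Rightarrow> 'a set set set \<Rightarrow> 'a set set set"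
  where "generated_uniformity X \<S> =
    {\<alpha> \<in> covers X. \<exists>\<C>. finite \<C> \<and> \<C> \<subseteq> \<S> \<and> cover_refines (cover_meet X \<C>) \<alpha>}"

definition star :: "'a \<Rightarrow> 'a set set \<Rightarrow> 'a set"
  where "star x \<alpha> = \<Union>{A \<in> \<alpha>. x \<in> A}"

definition uniform_topology :: "'a set \<Rightarrow> 'a set set set \<Rightarrow> 'a topology"
  where "uniform_topology X \<U> =
    topology (\<lambda>W. W \<subseteq> X \<and> (\<forall>x\<in>W. \<exists>\<alpha>\<in>\<U>. star x \<alpha> \<subseteq> W))"

lemma cover_refines_trans:
  "\<lbrakk>cover_refines \<alpha> \<beta>; cover_refines \<beta> \<gamma>\<rbrakk> \<Longrightarrow> cover_refines \<alpha> \<gamma>"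
  unfolding cover_refines_def by (meson subset_trans)

lemma star_mono_refines:
  assumes "cover_refines \<gamma> \<alpha>"
  shows "star x \<gamma> \<subseteq> star x \<alpha>"
  using assms unfolding star_def cover_refines_def by fast

lemma openin_uniform_topology:
  assumes "\<And>\<alpha> \<beta>. \<lbrakk>\<alpha> \<in> \<U>; \<beta> \<in> \<U>\<rbrakk> \<Longrightarrow> \<exists>\<gamma>\<in>\<U>. cover_refines \<gamma> \<alpha> \<and> cover_refines \<gamma> \<beta>"
  shows "openin (uniform_topology X \<U>) W \<longleftrightarrow> W \<subseteq> X \<and> (\<forall>x\<in>W. \<exists>\<alpha>\<in>\<U>. star x \<alpha> \<subseteq> W)"
proof -
  have "istopology (\<lambda>W. W \<subseteq> X \<and> (\<forall>x\<in>W. \<exists>\<alpha>\<in>\<U>. star x \<alpha> \<subseteq> W))"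
    unfolding istopology_def
  proof (rule conjI; clarify)
    fix S T
    assume S: "S \<subseteq> X" "\<forall>x\<in>S. \<exists>\<alpha>\<in>\<U>. star x \<alpha> \<subseteq> S"
      and T: "T \<subseteq> X" "\<forall>x\<in>T. \<exists>\<alpha>\<in>\<U>. star x \<alpha> \<subseteq> T"
    have "\<exists>\<gamma>\<in>\<U>. star x \<gamma> \<subseteq> S \<inter> T" if x: "x \<in> S" "x \<in> T" for x
    proof -
      obtain \<alpha> \<beta> where "\<alpha> \<in> \<U>" "star x \<alpha> \<subseteq> S" "\<beta> \<in> \<U>" "star x \<beta> \<subseteq> T"
        using S(2) T(2) x by blast
      moreover obtain \<gamma> where "\<gamma> \<in> \<U>" "cover_refines \<gamma> \<alpha>" "cover_refines \<gamma> \<beta>"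
        using assms calculation by blast
      ultimately show ?thesis
        using star_mono_refines by (metis Int_greatest order_trans)
    qed
    then show "S \<inter> T \<subseteq> X \<and> (\<forall>x\<in>S \<inter> T. \<exists>\<alpha>\<in>\<U>. star x \<alpha> \<subseteq> S \<inter> T)"
      using S(1) by blast
  next
    fix \<K> :: "'a set set"
    assume K: "\<forall>K\<in>\<K>. K \<subseteq> X \<and> (\<forall>x\<in>K. \<exists>\<alpha>\<in>\<U>. star x \<alpha> \<subseteq> K)"
    have "\<exists>\<alpha>\<in>\<U>. star x \<alpha> \<subseteq> \<Union>\<K>" if "K \<in> \<K>" "x \<in> K" for x K
      using K that by (meson Sup_upper order_trans)
    then show "\<Union>\<K> \<subseteq> X \<and> (\<forall>x\<in>\<Union>\<K>. \<exists>\<alpha>\<in>\<U>. star x \<alpha> \<subseteq> \<Union>\<K>)"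
      using K by blast
  qed
  then show ?thesis
    by (simp add: uniform_topology_def)
qed


lemma topspace_uniform_topology:
  assumes "\<And>\<alpha> \<beta>. \<lbrakk>\<alpha> \<in> \<U>; \<beta> \<in> \<U>\<rbrakk> \<Longrightarrow> \<exists>\<gamma>\<in>\<U>. cover_refines \<gamma> \<alpha> \<and> cover_refines \<gamma> \<beta>"
    and "\<U> \<noteq> {}" and "\<U> \<subseteq> covers X"
  shows "topspace (uniform_topology X \<U>) = X"
proof -
  have op: "openin (uniform_topology X \<U>) W \<longleftrightarrow> W \<subseteq> X \<and> (\<forall>x\<in>W. \<exists>\<alpha>\<in>\<U>. star x \<alpha> \<subseteq> W)" for W
    using assms(1) by (rule openin_uniform_topology)
  have "star x \<alpha> \<subseteq> X" if "\<alpha> \<in> \<U>" for x \<alpha>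
    using that assms(3) unfolding star_def covers_def by blast
  then have "openin (uniform_topology X \<U>) X"
    using assms(2) unfolding op by blast
  moreover have "W \<subseteq> X" if "openin (uniform_topology X \<U>) W" for W
    using that op by blast
  ultimately show ?thesis
    by (metis openin_subset openin_topspace subset_antisym)
qed

lemma cover_meet_antimono:
  assumes "\<C> \<subseteq> \<D>"
  shows "cover_refines (cover_meet X \<D>) (cover_meet X \<C>)"
  unfolding cover_refines_def
proof
  fix A assume "A \<in> cover_meet X \<D>"
  then obtain f where f: "A = X \<inter> (\<Inter>\<alpha>\<in>\<D>. f \<alpha>)" "\<forall>\<alpha>\<in>\<D>. f \<alpha> \<in> \<alpha>"
    unfolding cover_meet_def mem_Collect_eq by (elim exE conjE)
  have "X \<inter> (\<Inter>\<alpha>\<in>\<C>. f \<alpha>) \<in> cover_meet X \<C>"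
    using f(2) assms unfolding cover_meet_def mem_Collect_eq
    by (intro exI[of _ f] conjI refl) (use subsetD in fast)
  moreover have "A \<subseteq> X \<inter> (\<Inter>\<alpha>\<in>\<C>. f \<alpha>)"
    using f(1) assms by blast
  ultimately show "\<exists>B\<in>cover_meet X \<C>. A \<subseteq> B" ..
qed

lemma generated_uniformity_refine:
  assumes \<S>: "\<S> \<subseteq> covers X"
    and \<alpha>: "\<alpha> \<in> generated_uniformity X \<S>" and \<beta>: "\<beta> \<in> generated_uniformity X \<S>"
  shows "\<exists>\<gamma>\<in>generated_uniformity X \<S>. cover_refines \<gamma> \<alpha> \<and> cover_refines \<gamma> \<beta>"
proof -
  obtain \<C> where \<C>: "finite \<C>" "\<C> \<subseteq> \<S>" "cover_refines (cover_meet X \<C>) \<alpha>"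
    using \<alpha> unfolding generated_uniformity_def by blast
  obtain \<D> where \<D>: "finite \<D>" "\<D> \<subseteq> \<S>" "cover_refines (cover_meet X \<D>) \<beta>"
    using \<beta> unfolding generated_uniformity_def by blast
  let ?\<gamma> = "cover_meet X (\<C> \<union> \<D>)"
  have "x \<in> \<Union>?\<gamma>" if "x \<in> X" for x
  proof -
    have "\<Union>\<delta> = X" if "\<delta> \<in> \<C> \<union> \<D>" for \<delta>
      using that \<C>(2) \<D>(2) \<S> by (auto simp: covers_def)
    then have "\<forall>\<delta>\<in>\<C> \<union> \<D>. \<exists>A\<in>\<delta>. x \<in> A"
      using \<open>x \<in> X\<close> by (metis UnionE)
    then obtain f where "\<forall>\<delta>\<in>\<C> \<union> \<D>. f \<delta> \<in> \<delta> \<and> x \<in> f \<delta>"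
      by metis
    then show ?thesis
      using that unfolding cover_meet_def by blast
  qed
  then have "?\<gamma> \<in> covers X"
    unfolding covers_def cover_meet_def by blast
  then have "?\<gamma> \<in> generated_uniformity X \<S>"
    unfolding generated_uniformity_def cover_refines_def using \<C>(1,2) \<D>(1,2)
    by (intro CollectI conjI exI[of _ "\<C> \<union> \<D>"]) auto
  moreover have "cover_refines ?\<gamma> (cover_meet X \<C>)" "cover_refines ?\<gamma> (cover_meet X \<D>)"
    by (simp_all add: cover_meet_antimono)
  ultimately show ?thesis
    using cover_refines_trans[OF _ \<C>(3)] cover_refines_trans[OF _ \<D>(3)] by blast
qed

lemma trivial_cover_in_generated_uniformity: "{X} \<in> generated_uniformity X \<S>"
  unfolding generated_uniformity_def covers_def cover_refines_def cover_meet_def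
  by (intro CollectI conjI exI[of _ "{}"]) auto

lemma generated_uniformity_subset_covers: "generated_uniformity X \<S> \<subseteq> covers X"
  unfolding generated_uniformity_def by blast


section \<open>The median uniformity and topology\<close>

definition median_uniformity :: "'a set \<Rightarrow> ('a \<Rightarrow> 'a \<Rightarrow> 'a \<Rightarrow> 'a) \<Rightarrow> 'a set set set"
  where "median_uniformity X m =
    generated_uniformity X
      {{branch X m u v, branch X m v u} | u v. chain_interval X m u v \<and> u \<noteq> v}"

definition median_topology :: "'a set \<Rightarrow> ('a \<Rightarrow> 'a \<Rightarrow> 'a \<Rightarrow> 'a) \<Rightarrow> 'a topology"
  where "median_topology X m = uniform_topology X (median_uniformity X m)"


lemma median_subbase_covers:
  "{{branch X m u v, branch X m v u} | u v. chain_interval X m u v \<and> u \<noteq> v} \<subseteq> covers X"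
  if "median_algebra X m"
proof -
  have "m u x v = m v x u" if "u \<in> X" "v \<in> X" "x \<in> X" for u v x
    using \<open>median_algebra X m\<close> that by (simp add: median_algebra.sym12 median_algebra.sym23)
  then have *: "{branch X m u v, branch X m v u} \<in> covers X" if "u \<in> X" "v \<in> X" "u \<noteq> v" for u v
    using that unfolding branch_def covers_def by auto
  show ?thesis
  proof
    fix \<alpha> assume "\<alpha> \<in> {{branch X m u v, branch X m v u} | u v. chain_interval X m u v \<and> u \<noteq> v}"
    then obtain u v where "\<alpha> = {branch X m u v, branch X m v u}" "chain_interval X m u v" "u \<noteq> v"
      unfolding mem_Collect_eq by (elim exE conjE)
    then show "\<alpha> \<in> covers X"
      using * by (simp add: chain_interval_def)
  qed
qed

lemma median_uniformity_refine:
  assumes "median_algebra X m"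
    and "\<alpha> \<in> median_uniformity X m" "\<beta> \<in> median_uniformity X m"
  shows "\<exists>\<gamma>\<in>median_uniformity X m. cover_refines \<gamma> \<alpha> \<and> cover_refines \<gamma> \<beta>"
  using generated_uniformity_refine[OF median_subbase_covers[OF assms(1)]
      assms(2,3)[unfolded median_uniformity_def]]
  unfolding median_uniformity_def .

lemma topspace_median_topology:
  assumes "median_algebra X m"
  shows "topspace (median_topology X m) = X"
  unfolding median_topology_def
proof (rule topspace_uniform_topology)
  show "median_uniformity X m \<noteq> {}"
    unfolding median_uniformity_def
    by (rule ex_in_conv[THEN iffD1, OF exI, OF trivial_cover_in_generated_uniformity])
  show "median_uniformity X m \<subseteq> covers X"
    unfolding median_uniformity_def by (rule generated_uniformity_subset_covers)
qed (rule median_uniformity_refine[OF assms])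


section \<open>The Hausdorff completion of a uniformity\<close>

definition cauchy_filter_on :: "'a set \<Rightarrow> 'a set set set \<Rightarrow> 'a filter \<Rightarrow> bool"
  where "cauchy_filter_on X \<U> F \<longleftrightarrow>
    F \<noteq> bot \<and> F \<le> principal X \<and> (\<forall>\<alpha>\<in>\<U>. \<exists>A\<in>\<alpha>. eventually (\<lambda>x. x \<in> A) F)"

text \<open>The points of the completion are the minimal Cauchy filters. Since \<open>F \<le> F'\<close> means that
  \<open>F\<close> is finer than \<open>F'\<close> (has more sets), these are the \<open>\<le>\<close>-maximal elements.\<close>

definition completion_points :: "'a set \<Rightarrow> 'a set set set \<Rightarrow> 'a filter set"
  where "completion_points X \<U> =
    {F. cauchy_filter_on X \<U> F \<and> (\<forall>F'. cauchy_filter_on X \<U> F' \<and> F \<le> F' \<longrightarrow> F' = F)}"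

definition completion_extent :: "'a set \<Rightarrow> 'a set set set \<Rightarrow> 'a set \<Rightarrow> 'a filter set"
  where "completion_extent X \<U> A = {F \<in> completion_points X \<U>. eventually (\<lambda>x. x \<in> A) F}"

definition completion_uniformity :: "'a set \<Rightarrow> 'a set set set \<Rightarrow> 'a filter set set set"
  where "completion_uniformity X \<U> =
    {\<beta> \<in> covers (completion_points X \<U>).
      \<exists>\<alpha>\<in>\<U>. cover_refines (completion_extent X \<U> ` \<alpha>) \<beta>}"

lemma completion_uniformity_refine:
  assumes \<U>: "\<And>\<alpha> \<beta>. \<lbrakk>\<alpha> \<in> \<U>; \<beta> \<in> \<U>\<rbrakk> \<Longrightarrow> \<exists>\<gamma>\<in>\<U>. cover_refines \<gamma> \<alpha> \<and> cover_refines \<gamma> \<beta>"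
    and \<alpha>': "\<alpha>' \<in> completion_uniformity X \<U>" and \<beta>': "\<beta>' \<in> completion_uniformity X \<U>"
  shows "\<exists>\<gamma>\<in>completion_uniformity X \<U>. cover_refines \<gamma> \<alpha>' \<and> cover_refines \<gamma> \<beta>'"
proof -
  let ?e = "completion_extent X \<U>"
  obtain \<alpha> where \<alpha>: "\<alpha> \<in> \<U>" "cover_refines (?e ` \<alpha>) \<alpha>'"
    using \<alpha>' unfolding completion_uniformity_def by blast
  obtain \<beta> where \<beta>: "\<beta> \<in> \<U>" "cover_refines (?e ` \<beta>) \<beta>'"
    using \<beta>' unfolding completion_uniformity_def by blast
  obtain \<gamma> where \<gamma>: "\<gamma> \<in> \<U>" "cover_refines \<gamma> \<alpha>" "cover_refines \<gamma> \<beta>"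
    using \<U>[OF \<alpha>(1) \<beta>(1)] by blast
  have mono: "?e A \<subseteq> ?e B" if "A \<subseteq> B" for A B
    using that unfolding completion_extent_def by (auto elim: eventually_mono)
  have refines: "cover_refines (?e ` \<gamma>) (?e ` \<delta>)" if "cover_refines \<gamma> \<delta>" for \<delta>
    unfolding cover_refines_def
  proof
    fix E assume "E \<in> ?e ` \<gamma>"
    then obtain A where A: "A \<in> \<gamma>" "E = ?e A" by (elim imageE)
    then obtain B where B: "B \<in> \<delta>" "A \<subseteq> B"
      using \<open>cover_refines \<gamma> \<delta>\<close> unfolding cover_refines_def by (elim ballE bexE) auto
    have "E \<subseteq> ?e B"
      using A(2) mono[OF B(2)] by simp
    then show "\<exists>D\<in>?e ` \<delta>. E \<subseteq> D"
      using B(1) by (rule bexI[OF _ imageI])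
  qed
  have "\<exists>A\<in>\<gamma>. F \<in> ?e A" if F: "F \<in> completion_points X \<U>" for F
  proof -
    have "cauchy_filter_on X \<U> F"
      using F by (simp add: completion_points_def)
    then show ?thesis
      using F \<gamma>(1) by (simp add: completion_extent_def cauchy_filter_on_def)
  qed
  moreover have "F \<in> completion_points X \<U>" if "F \<in> ?e A" for F A
    using that by (simp add: completion_extent_def)
  ultimately have "\<Union>(?e ` \<gamma>) = completion_points X \<U>"
    by (intro subset_antisym UN_least subsetI) auto
  moreover have "cover_refines (?e ` \<gamma>) (?e ` \<gamma>)"
    unfolding cover_refines_def by (rule ballI, rule bexI, rule subset_refl)
  ultimately have "?e ` \<gamma> \<in> completion_uniformity X \<U>"
    unfolding completion_uniformity_def covers_def mem_Collect_eq
    using \<gamma>(1) by (intro conjI bexI[of _ \<gamma>])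
  moreover have "cover_refines (?e ` \<gamma>) \<alpha>'" "cover_refines (?e ` \<gamma>) \<beta>'"
    using cover_refines_trans[OF refines[OF \<gamma>(2)] \<alpha>(2)]
      cover_refines_trans[OF refines[OF \<gamma>(3)] \<beta>(2)] by simp_all
  ultimately show ?thesis
    by (intro bexI[of _ "?e ` \<gamma>"] conjI)
qed

definition completion_topology :: "'a set \<Rightarrow> 'a set set set \<Rightarrow> 'a filter topology"
  where "completion_topology X \<U> =
    uniform_topology (completion_points X \<U>) (completion_uniformity X \<U>)"

lemma topspace_completion_topology:
  assumes "\<And>\<alpha> \<beta>. \<lbrakk>\<alpha> \<in> \<U>; \<beta> \<in> \<U>\<rbrakk> \<Longrightarrow> \<exists>\<gamma>\<in>\<U>. cover_refines \<gamma> \<alpha> \<and> cover_refines \<gamma> \<beta>"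
    and "\<U> \<noteq> {}"
  shows "topspace (completion_topology X \<U>) = completion_points X \<U>"
  unfolding completion_topology_def
proof (rule topspace_uniform_topology)
  obtain \<alpha> where "\<alpha> \<in> \<U>"
    using assms(2) by blast
  then have "{completion_points X \<U>} \<in> completion_uniformity X \<U>"
    unfolding completion_uniformity_def covers_def cover_refines_def completion_extent_def
    by auto
  then show "completion_uniformity X \<U> \<noteq> {}"
    by blast
  show "completion_uniformity X \<U> \<subseteq> covers (completion_points X \<U>)"
    unfolding completion_uniformity_def by blast
qed (rule completion_uniformity_refine[OF assms(1)])

definition completion_map :: "'a set \<Rightarrow> 'a set set set \<Rightarrow> 'a \<Rightarrow> 'a filter"
  where "completion_map X \<U> x = nhdsin (uniform_topology X \<U>) x"


section \<open>Topological median algebras and the minimal median compactification\<close>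

definition continuous_ternary :: "'a topology \<Rightarrow> ('a \<Rightarrow> 'a \<Rightarrow> 'a \<Rightarrow> 'a) \<Rightarrow> bool"
  where "continuous_ternary T m \<longleftrightarrow>
    continuous_map (prod_topology T (prod_topology T T)) T (\<lambda>(x, y, z). m x y z)"

definition topological_median_algebra :: "'a topology \<Rightarrow> ('a \<Rightarrow> 'a \<Rightarrow> 'a \<Rightarrow> 'a) \<Rightarrow> bool"
  where "topological_median_algebra T m \<longleftrightarrow>
    median_algebra (topspace T) m \<and> continuous_ternary T m"

definition median_preserving ::
    "'a set \<Rightarrow> ('a \<Rightarrow> 'a \<Rightarrow> 'a \<Rightarrow> 'a) \<Rightarrow> ('b \<Rightarrow> 'b \<Rightarrow> 'b \<Rightarrow> 'b) \<Rightarrow> ('a \<Rightarrow> 'b) \<Rightarrow> bool"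
  where "median_preserving X m m' f \<longleftrightarrow>
    (\<forall>x\<in>X. \<forall>y\<in>X. \<forall>z\<in>X. f (m x y z) = m' (f x) (f y) (f z))"

definition mmc :: "'a set \<Rightarrow> ('a \<Rightarrow> 'a \<Rightarrow> 'a \<Rightarrow> 'a) \<Rightarrow> 'a filter set"
  where "mmc X m = completion_points X (median_uniformity X m)"

definition mmc_topology :: "'a set \<Rightarrow> ('a \<Rightarrow> 'a \<Rightarrow> 'a \<Rightarrow> 'a) \<Rightarrow> 'a filter topology"
  where "mmc_topology X m = completion_topology X (median_uniformity X m)"

lemma topspace_mmc_topology:
  assumes "median_algebra X m"
  shows "topspace (mmc_topology X m) = mmc X m"
  unfolding mmc_topology_def mmc_def
proof (rule topspace_completion_topology)
  show "median_uniformity X m \<noteq> {}"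
    unfolding median_uniformity_def
    by (rule ex_in_conv[THEN iffD1, OF exI, OF trivial_cover_in_generated_uniformity])
qed (rule median_uniformity_refine[OF assms])

definition mmc_map :: "'a set \<Rightarrow> ('a \<Rightarrow> 'a \<Rightarrow> 'a \<Rightarrow> 'a) \<Rightarrow> 'a \<Rightarrow> 'a filter"
  where "mmc_map X m = completion_map X (median_uniformity X m)"

text \<open>The continuous extension of the median is unique on \<open>mmc X m\<close>, so the choice
  only affects irrelevant values outside the carrier. That such an extension
  exists is part of \<open>proper_median_G_compactification\<close> below.\<close>

definition mmc_median ::
    "'a set \<Rightarrow> ('a \<Rightarrow> 'a \<Rightarrow> 'a \<Rightarrow> 'a) \<Rightarrow> 'a filter \<Rightarrow> 'a filter \<Rightarrow> 'a filter \<Rightarrow> 'a filter"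
  where "mmc_median X m =
    (SOME M. continuous_ternary (mmc_topology X m) M \<and>
             median_preserving X m M (mmc_map X m))"


section \<open>Topological groups and their actions\<close>

definition topological_group :: "('g, 'r) monoid_scheme \<Rightarrow> 'g topology \<Rightarrow> bool"
  where "topological_group G TG \<longleftrightarrow>
    group G \<and> topspace TG = carrier G \<and>
    continuous_map (prod_topology TG TG) TG (\<lambda>(g, h). g \<otimes>\<^bsub>G\<^esub> h) \<and>
    continuous_map TG TG (\<lambda>g. inv\<^bsub>G\<^esub> g)"

definition separately_continuous_action ::
    "('g, 'r) monoid_scheme \<Rightarrow> 'g topology \<Rightarrow> 'a topology \<Rightarrow> ('g \<Rightarrow> 'a \<Rightarrow> 'a) \<Rightarrow> bool"
  where "separately_continuous_action G TG T \<phi> \<longleftrightarrow>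
    group_action G (topspace T) \<phi> \<and>
    (\<forall>g\<in>carrier G. continuous_map T T (\<phi> g)) \<and>
    (\<forall>x\<in>topspace T. continuous_map TG T (\<lambda>g. \<phi> g x))"

definition jointly_continuous_action ::
    "('g, 'r) monoid_scheme \<Rightarrow> 'g topology \<Rightarrow> 'a topology \<Rightarrow> ('g \<Rightarrow> 'a \<Rightarrow> 'a) \<Rightarrow> bool"
  where "jointly_continuous_action G TG T \<phi> \<longleftrightarrow>
    group_action G (topspace T) \<phi> \<and>
    continuous_map (prod_topology TG T) T (\<lambda>(g, x). \<phi> g x)"

text \<open>For a group action every \<open>\<phi> g\<close> is a bijection of the carrier, so it is a median
  automorphism as soon as it preserves the median.\<close>

definition acts_by_median_automorphisms ::
    "('g, 'r) monoid_scheme \<Rightarrow> 'a set \<Rightarrow> ('a \<Rightarrow> 'a \<Rightarrow> 'a \<Rightarrow> 'a) \<Rightarrow> ('g \<Rightarrow> 'a \<Rightarrow> 'a) \<Rightarrow> bool"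
  where "acts_by_median_automorphisms G X m \<phi> \<longleftrightarrow>
    group_action G X \<phi> \<and> (\<forall>g\<in>carrier G. median_preserving X m m (\<phi> g))"

definition G_bounded ::
    "('g, 'r) monoid_scheme \<Rightarrow> 'g topology \<Rightarrow> 'a set \<Rightarrow> ('g \<Rightarrow> 'a \<Rightarrow> 'a) \<Rightarrow> 'a set set set \<Rightarrow> bool"
  where "G_bounded G TG X \<phi> \<U> \<longleftrightarrow>
    (\<forall>\<alpha>\<in>\<U>. \<exists>V. V \<subseteq> carrier G \<and> (\<exists>N. openin TG N \<and> \<one>\<^bsub>G\<^esub> \<in> N \<and> N \<subseteq> V) \<and>
       cover_refines ((\<lambda>x. (\<lambda>g. \<phi> g x) ` V) ` X) \<alpha>)"

definition equivariant ::
    "('g, 'r) monoid_scheme \<Rightarrow> 'a set \<Rightarrow> ('g \<Rightarrow> 'a \<Rightarrow> 'a) \<Rightarrow> ('g \<Rightarrow> 'b \<Rightarrow> 'b) \<Rightarrow> ('a \<Rightarrow> 'b) \<Rightarrow> bool"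
  where "equivariant G X \<phi> \<psi> f \<longleftrightarrow> (\<forall>g\<in>carrier G. \<forall>x\<in>X. f (\<phi> g x) = \<psi> g (f x))"

text \<open>The source is the median algebra \<open>(topspace T, m)\<close> with topology \<open>T\<close> and action \<open>\<phi>\<close>;
  the target is \<open>(topspace T', m')\<close> with topology \<open>T'\<close> and action \<open>\<psi>\<close>.\<close>

definition proper_median_G_compactification ::
    "('g, 'r) monoid_scheme \<Rightarrow> 'g topology \<Rightarrow>
     'a topology \<Rightarrow> ('a \<Rightarrow> 'a \<Rightarrow> 'a \<Rightarrow> 'a) \<Rightarrow> ('g \<Rightarrow> 'a \<Rightarrow> 'a) \<Rightarrow>
     'b topology \<Rightarrow> ('b \<Rightarrow> 'b \<Rightarrow> 'b \<Rightarrow> 'b) \<Rightarrow> ('g \<Rightarrow> 'b \<Rightarrow> 'b) \<Rightarrow> ('a \<Rightarrow> 'b) \<Rightarrow> bool"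
  where "proper_median_G_compactification G TG T m \<phi> T' m' \<psi> f \<longleftrightarrow>
    compact_space T' \<and> Hausdorff_space T' \<and> topological_median_algebra T' m' \<and>
    jointly_continuous_action G TG T' \<psi> \<and>
    acts_by_median_automorphisms G (topspace T') m' \<psi> \<and>
    embedding_map T T' f \<and> Abstract_Topology.closure_of T' (f ` topspace T) = topspace T' \<and>
    median_preserving (topspace T) m m' f \<and>
    equivariant G (topspace T) \<phi> \<psi> f"

end

theory Submission
  imports Defs
begin

text \<open>The engine is that branches behave like half-spaces. If $[u,v]$ is a chain interval, then of
three points \<open>x\<close>, \<open>y\<close>, \<open>p\<close> with \<open>p\<close> between \<open>x\<close> and \<open>y\<close>, the point \<open>p\<close> lies in $B^u_v$ as soon as
\<open>x\<close> and \<open>y\<close> do (\<open>branch_majority\<close>): if not, then \<open>v\<close> is between \<open>u\<close> and \<open>p\<close>, and whichever of the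
projections of \<open>x\<close>, \<open>y\<close> to the chain $[u,v]$ is closer to \<open>v\<close> is between \<open>v\<close> and \<open>p\<close>, because it
is between \<open>v\<close> and the gate $m(x,v,y)$ of \<open>v\<close> in $[x,y]$; so it equals \<open>v\<close>.

Boundedness follows from this and from orbit continuity at finitely many points. Let \<open>w\<close> be in
$[u,v]$ with \<open>w \<noteq> v\<close>. Some branch $B^v_a$ at \<open>v\<close> misses a neighbourhood \<open>N\<close> of \<open>w\<close>
(\<open>separating_branch\<close>). Take \<open>g\<close> so close to the identity that \<open>gw \<in> N\<close> and $gv \in B^v_a$. If \<open>w\<close> is
between \<open>v\<close> and \<open>x\<close>, then \<open>gw\<close> is between \<open>gv\<close> and \<open>gx\<close>; were \<open>gx\<close> outside $B^u_v$, then
$gx \in B^v_a$, hence $gw \in B^v_a$, a contradiction. This controls all such \<open>x\<close> at once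
(\<open>one_sided_bound\<close>). Since every \<open>x\<close> is on one side of a suitable \<open>w\<close>, the subbasic covers, and with
them all uniform covers, are bounded.

For the compactification, the branch covers do generate a uniformity: a point \<open>w\<close> strictly inside
$[u,v]$ gives a barycentric refinement by the covers of $[u,w]$ and $[w,v]$, and without such a
point the cover is a partition. The points of the completion are the minimal Cauchy filters;
every Cauchy filter lies below exactly one of them, its round filter, and the sets of filters
containing a given set \<open>A\<close> form a base of the topology (\<open>openin_hat\<close>). The completion is compact
because ultrafilters are Cauchy: an ultrafilter picks a side of every chain interval.
Both the action and the median are extended by one principle (\<open>continuous_map_round\<close>): a family of
Cauchy filters \<open>\<Phi> t\<close> has continuously varying limits if each \<open>D \<in> \<Phi> t\<close> has arbitrarily small uniform
thickenings which belong to \<open>\<Phi> s\<close> for all \<open>s\<close> near \<open>t\<close>. For the action the thickening is supplied by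
boundedness, and this is where joint continuity comes from; for the median the images of three
Cauchy filters are Cauchy because two of the three filters choose the same side of a chain interval.
Identities, automorphy and uniqueness pass to the completion by density, and joint continuity on
\<open>X\<close> is inherited through the embedding.\<close>

section \<open>Betweenness in a median algebra\<close>

text \<open>In \<open>lies_between m x a b\<close> the point \<open>a\<close> is the one in the middle. For fixed \<open>x\<close> this is the order of
the meet semilattice with bottom \<open>x\<close> and meet $(a,b) \mapsto m(a,x,b)$.\<close>

definition lies_between :: "('a \<Rightarrow> 'a \<Rightarrow> 'a \<Rightarrow> 'a) \<Rightarrow> 'a \<Rightarrow> 'a \<Rightarrow> 'a \<Rightarrow> bool"
  where "lies_between m x a b \<longleftrightarrow> m x a b = a"

context median_algebra
begin

lemma perm:
  assumes "x \<in> X" "y \<in> X" "z \<in> X"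
  shows "m y x z = m x y z" "m x z y = m x y z" "m z y x = m x y z" "m y z x = m x y z" "m z x y = m x y z"
  using assms sym12 sym23 by metis+

lemma between_commute:
  assumes "x \<in> X" "a \<in> X" "b \<in> X"
  shows "lies_between m x a b \<longleftrightarrow> lies_between m b a x"
  using perm(3)[of x a b] assms by (simp add: lies_between_def)

lemma between_refl:
  assumes "a \<in> X" "b \<in> X"
  shows "lies_between m a a b" "lies_between m b a a"
  using perm(2)[of a a b] perm(3)[of a a b] perm(1)[of b a a] majority[of b a] assms
  by (simp_all add: lies_between_def perm)

lemma between_antisym:
  assumes "x \<in> X" "a \<in> X" "b \<in> X" "lies_between m x a b" "lies_between m x b a"
  shows "a = b"
  using assms perm(2)[of x a b] by (simp add: lies_between_def)

text \<open>Both conclusions are instances of the associative law, read in the semilattices with bottoms \<open>x\<close>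
and \<open>b\<close>. They say that four points in this position are arranged along a line, and almost all later
arguments with betweenness rest on them.\<close>

lemma between_trans:
  assumes "x \<in> X" "a \<in> X" "b \<in> X" "c \<in> X" and ab: "lies_between m x a b" and bc: "lies_between m x b c"
  shows "lies_between m x a c" "lies_between m a b c"
proof -
  have "m a x c = m a x b"
    using assoc[of a b c x] ab bc assms(1-4) by (simp add: lies_between_def perm)
  then show "lies_between m x a c"
    using ab assms(1-4) perm(1)[of x a c] perm(1)[of x a b] by (simp add: lies_between_def)
  have "m (m a b x) b c = m a b (m x b c)"
    using assoc[of a x c b] assms(1-4) by simp
  moreover have "m a b x = a"
    using ab perm(5)[of a b x] assms(1-4) by (simp add: lies_between_def)
  ultimately show "lies_between m a b c"
    using bc majority[of a b] assms(1-4) by (simp add: lies_between_def)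
qed

lemma median_between:
  assumes "x \<in> X" "y \<in> X" "z \<in> X"
  shows "lies_between m x (m x y z) y" "lies_between m y (m x y z) z" "lies_between m x (m x y z) z"
proof -
  have *: "lies_between m b (m b a c) a" if "a \<in> X" "b \<in> X" "c \<in> X" for a b c
  proof -
    have "m (m c b a) b a = m c b (m a b a)"
      using assoc[of c a a b] that by simp
    moreover have "m a b a = a"
      using that majority[of b a] perm(1)[of a b a] by simp
    ultimately have "m (m b a c) b a = m b a c"
      using that perm[of b a c] by simp
    then show ?thesis
      using perm(1)[of b "m b a c" a] that closed by (simp add: lies_between_def)
  qed
  show "lies_between m x (m x y z) y" using *[of y x z] assms by simp
  show "lies_between m y (m x y z) z" using *[of z y x] assms perm(5)[of x y z] perm(4)[of x y z] by simp
  show "lies_between m x (m x y z) z" using *[of z x y] assms perm(2)[of x y z] by simp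
qed

lemma between_median:
  assumes "v \<in> X" "w \<in> X" "x \<in> X" "y \<in> X" "lies_between m v w x" "lies_between m v w y"
  shows "lies_between m v w (m x v y)"
proof -
  have "m (m w v x) v y = m w v (m x v y)"
    using assoc[of w x y v] assms by simp
  then show ?thesis
    using assms closed[of x v y] perm(1)[of v w x] perm(1)[of v w y] perm(1)[of v w "m x v y"]
    by (simp add: lies_between_def)
qed

lemma median_unique:
  assumes X: "a \<in> X" "b \<in> X" "c \<in> X" "p \<in> X"
    and p: "lies_between m a p b" "lies_between m b p c" "lies_between m a p c"
  shows "p = m a b c"
proof -
  let ?q = "m a b c"
  have q: "?q \<in> X" using X closed by simp
  have "lies_between m a p ?q"
    using between_median[of a p b c] X p perm(1)[of a b c] by simp
  moreover have "lies_between m b p ?q"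
    using between_median[of b p a c] X p between_commute by simp
  ultimately have "lies_between m ?q p (m a ?q b)"
    using between_median[of ?q p a b] X q between_commute by simp
  moreover have "m a ?q b = ?q"
    using median_between(1)[of a b c] X by (simp add: lies_between_def)
  ultimately show ?thesis
    using X q majority[of p ?q] perm[of ?q p ?q] by (simp add: lies_between_def)
qed

text \<open>The point $m(x,v,y)$ is the gate of \<open>v\<close> in the interval $[x,y]$. Projecting \<open>v\<close> to $[x,p]$ and to $[p,y]$ gives \<open>r\<close> and \<open>t\<close>, arranged as
\<open>x\<close>, \<open>r\<close>, \<open>p\<close>, \<open>t\<close>, \<open>y\<close>, and then $m(r,v,t)$ satisfies the conditions which characterise the median of
\<open>x\<close>, \<open>v\<close>, \<open>y\<close>. This replaces an appeal to the distributive law, which is much harder to derive from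
the associative one.\<close>

lemma gate_between:
  assumes X: "x \<in> X" "y \<in> X" "v \<in> X" "p \<in> X" and p: "lies_between m x p y"
  shows "lies_between m v (m x v y) p"
proof -
  define r where "r = m x v p"
  define t where "t = m y v p"
  define s where "s = m r v t"
  have C[simp]: "r \<in> X" "t \<in> X" "s \<in> X" using X closed by (auto simp: r_def t_def s_def)
  have rx: "lies_between m x r p" "lies_between m x r v" "lies_between m v r p"
    unfolding r_def using median_between[of x v p] X by auto
  have ty: "lies_between m y t p" "lies_between m y t v" "lies_between m v t p"
    unfolding t_def using median_between[of y v p] X by auto
  have st: "lies_between m r s v" "lies_between m v s t" "lies_between m r s t"
    unfolding s_def using median_between[of r v t] X by auto
  have py: "lies_between m y p x" using p X between_commute by simp
  have tx: "lies_between m y t x" using between_trans(1)[of y t p x] ty(1) py X by simp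
  have "lies_between m t p x" using between_trans(2)[of y t p x] ty(1) py X by simp
  then have "lies_between m x p t" using X between_commute by simp
  then have xrt: "lies_between m x r t" using between_trans(1)[of x r p t] rx(1) X by simp
  have "lies_between m t s x"
    using between_trans(1)[of t s r x] st(3) xrt X between_commute by simp
  moreover have "lies_between m x t y" using tx X between_commute by simp
  ultimately have sxy: "lies_between m x s y"
    using between_trans(1)[of x s t y] X between_commute by simp
  have svx: "lies_between m x s v"
    using between_trans(1)[of v s r x] st(1) rx(2) X between_commute by simp
  have svy: "lies_between m v s y"
    using between_trans(1)[of v s t y] st(2) ty(2) X between_commute by simp
  have "s = m x v y"
    using median_unique[of x v y s] X sxy svx svy by simp
  moreover have "lies_between m v s p"
    using between_trans(1)[of v s t p] st(2) ty(3) X by simp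
  ultimately show ?thesis by simp
qed

section \<open>Chain intervals\<close>

lemma interval_iff: "z \<in> median_interval X m u v \<longleftrightarrow> z \<in> X \<and> lies_between m u z v"
  if "u \<in> X" "v \<in> X"
  using that perm(2)[of u _ v] by (auto simp: median_interval_def lies_between_def)

text \<open>The betweenness order with bottom \<open>u\<close> is, up to reversal, the only linear order that can witness that
$[u,v]$ is a chain, since \<open>u\<close> and \<open>v\<close> must be its endpoints. With this description subintervals and
images under automorphisms need no transport of a linear order.\<close>

lemma chain_interval_iff:
  "chain_interval X m u v \<longleftrightarrow> u \<in> X \<and> v \<in> X \<and>
    (\<forall>a\<in>X. \<forall>b\<in>X. lies_between m u a v \<and> lies_between m u b v \<longrightarrow> lies_between m u a b \<or> lies_between m u b a)"
proof (cases "u \<in> X \<and> v \<in> X")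
  case False
  then show ?thesis by (auto simp: chain_interval_def)
next
  case True
  then have X: "u \<in> X" "v \<in> X" by auto
  let ?C = "median_interval X m u v"
  have uv: "u \<in> ?C" "v \<in> ?C" using X interval_iff between_refl by auto
  show ?thesis
  proof
    assume "chain_interval X m u v"
    then obtain r where lin: "linear_order_on ?C r"
      and r: "\<And>a b c. \<lbrakk>a \<in> ?C; b \<in> ?C; c \<in> ?C; (a, b) \<in> r; (b, c) \<in> r\<rbrakk> \<Longrightarrow> m a b c = b"
      unfolding chain_interval_def median_chain_def by blast
    have tot: "(a, b) \<in> r \<or> (b, a) \<in> r" if "a \<in> ?C" "b \<in> ?C" for a b
      using lin that unfolding linear_order_on_def partial_order_on_def preorder_on_def
        total_on_def refl_on_def by metis
    have "lies_between m u a b \<or> lies_between m u b a" if a: "a \<in> ?C" and b: "b \<in> ?C" for a b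
    proof -
      have [simp]: "a \<in> X" "b \<in> X" using a b X by (auto simp: interval_iff)
      \<comment> \<open>A point of the interval on the side of \<open>u\<close> opposite to \<open>v\<close> has \<open>u\<close> between itself
        and \<open>v\<close>, while it is itself between \<open>u\<close> and \<open>v\<close>.\<close>
      have u_end: "u = a \<or> u = b" if au: "(a, u) \<in> r" "(u, b) \<in> r" "a \<in> ?C" "b \<in> ?C" for a b
      proof (cases "(u, v) \<in> r")
        case True
        then have "m a u v = u" using r uv au by blast
        moreover have "m u a v = a" using au(3) X by (simp add: interval_iff lies_between_def)
        ultimately show ?thesis using au(3) perm(1)[of u a v] X by (simp add: interval_iff)
      next
        case False
        then have "m v u b = u" using r uv au tot by blast
        moreover have "m u b v = b" using au(4) X by (simp add: interval_iff lies_between_def)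
        ultimately show ?thesis using au(4) perm(5)[of u b v] X by (simp add: interval_iff)
      qed
      consider "(u, a) \<in> r" "(a, b) \<in> r" | "(u, b) \<in> r" "(b, a) \<in> r"
        | "(a, b) \<in> r" "(b, u) \<in> r" | "(b, a) \<in> r" "(a, u) \<in> r"
        | "(a, u) \<in> r" "(u, b) \<in> r" | "(b, u) \<in> r" "(u, a) \<in> r"
        using tot a b uv by blast
      then show ?thesis
      proof cases
        case 1 then show ?thesis using r[of u a b] a b uv by (simp add: lies_between_def)
      next
        case 2 then show ?thesis using r[of u b a] a b uv by (simp add: lies_between_def)
      next
        case 3 then show ?thesis using r[of a b u] a b uv X perm(3)[of u b a] by (simp add: lies_between_def)
      next
        case 4 then show ?thesis using r[of b a u] a b uv X perm(3)[of u a b] by (simp add: lies_between_def)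
      next
        case 5 then show ?thesis using u_end[of a b] a b X between_refl by auto
      next
        case 6 then show ?thesis using u_end[of b a] a b X between_refl by auto
      qed
    qed
    then show "u \<in> X \<and> v \<in> X \<and>
        (\<forall>a\<in>X. \<forall>b\<in>X. lies_between m u a v \<and> lies_between m u b v \<longrightarrow> lies_between m u a b \<or> lies_between m u b a)"
      using X interval_iff by auto
  next
    assume "u \<in> X \<and> v \<in> X \<and>
      (\<forall>a\<in>X. \<forall>b\<in>X. lies_between m u a v \<and> lies_between m u b v \<longrightarrow> lies_between m u a b \<or> lies_between m u b a)"
    then have tot: "lies_between m u a b \<or> lies_between m u b a" if "a \<in> ?C" "b \<in> ?C" for a b
      using that X interval_iff by auto
    have CX: "?C \<subseteq> X" by (auto simp: median_interval_def)
    define r where "r = {(a, b). a \<in> ?C \<and> b \<in> ?C \<and> lies_between m u a b}"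
    have mid: "m a b c = b" if "(a, b) \<in> r" "(b, c) \<in> r" for a b c
      using between_trans(2)[of u a b c] that X CX by (auto simp: r_def lies_between_def)
    have "linear_order_on ?C r"
      unfolding linear_order_on_def partial_order_on_def preorder_on_def
    proof (intro conjI)
      show "refl_on ?C r" using X CX between_refl(2)[of _ u] by (auto simp: refl_on_def r_def)
      show "r \<subseteq> ?C \<times> ?C" by (auto simp: r_def)
      show "trans r" using between_trans(1)[of u] X CX by (auto simp: r_def intro!: transI)
      show "antisym r" using between_antisym[of u] X CX by (auto simp: r_def intro!: antisymI)
      show "total_on ?C r" using tot by (auto simp: r_def total_on_def)
    qed
    moreover have "m a b c \<in> ?C" if abc: "a \<in> ?C" "b \<in> ?C" "c \<in> ?C" for a b c
    proof -
      have 3: "(a, b) \<in> r \<or> (b, a) \<in> r" "(c, b) \<in> r \<or> (b, c) \<in> r" "(a, c) \<in> r \<or> (c, a) \<in> r"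
        using tot abc by (auto simp: r_def)
      have "a \<in> X" "b \<in> X" "c \<in> X" using abc CX by auto
      then have "m a b c \<in> {a, b, c}"
        using 3 mid[of a b c] mid[of c b a] mid[of b a c] mid[of c a b] mid[of a c b] mid[of b c a]
          perm[of a b c] by auto
      then show ?thesis using abc by auto
    qed
    ultimately show "chain_interval X m u v"
      unfolding chain_interval_def median_chain_def median_subalgebra_def
      using X CX mid by blast
  qed
qed

lemma chain_intervalD:
  assumes "chain_interval X m u v"
  shows "u \<in> X" "v \<in> X"
  using assms by (auto simp: chain_interval_def)

lemma chain_interval_commute: "chain_interval X m u v \<Longrightarrow> chain_interval X m v u"
proof -
  assume *: "chain_interval X m u v"
  then have "median_interval X m u v = median_interval X m v u"
    using sym12 by (auto simp: median_interval_def chain_interval_def)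
  then show ?thesis using * by (simp add: chain_interval_def)
qed

lemma chain_interval_total:
  assumes "chain_interval X m u v" "a \<in> X" "b \<in> X" "lies_between m u a v" "lies_between m u b v"
  shows "lies_between m u a b \<and> lies_between m a b v \<or> lies_between m u b a \<and> lies_between m b a v"
  using assms between_trans(2)[of u a b v] between_trans(2)[of u b a v]
  unfolding chain_interval_iff by blast

lemma chain_subinterval:
  assumes uv: "chain_interval X m u v" and w: "w \<in> X" "lies_between m u w v"
  shows "chain_interval X m u w" "chain_interval X m w v"
proof -
  have *: "chain_interval X m a w" if ab: "chain_interval X m a b" "lies_between m a w b" for a b
    using that w(1) between_trans(1)[of a _ w b] unfolding chain_interval_iff by blast
  show "chain_interval X m u w" using * uv w by blast
  have "lies_between m v w u" using w chain_intervalD[OF uv] between_commute by simp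
  then have "chain_interval X m v w" using * chain_interval_commute[OF uv] by blast
  then show "chain_interval X m w v" using chain_interval_commute by blast
qed

section \<open>Branches\<close>

lemma branch_iff:
  assumes "u \<in> X" "v \<in> X"
  shows "x \<in> branch X m u v \<longleftrightarrow> x \<in> X \<and> \<not> lies_between m u v x"
  using assms perm(2)[of u v x] by (auto simp: branch_def lies_between_def)

lemma branch_subset: "branch X m u v \<subseteq> X"
  by (auto simp: branch_def)

text \<open>Branches of chain intervals are convex. The two projections to the chain are comparable, and the
one closer to \<open>v\<close>, called \<open>w\<close> below, is between \<open>v\<close> and both of \<open>x\<close>, \<open>y\<close>, hence between \<open>v\<close> and the
gate of \<open>v\<close> in $[x,y]$, hence between \<open>v\<close> and \<open>p\<close>. If also \<open>v\<close> is between \<open>u\<close> and \<open>p\<close>, only \<open>w = v\<close>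
is possible.\<close>

lemma branch_majority:
  assumes uv: "chain_interval X m u v"
    and x: "x \<in> branch X m u v" and y: "y \<in> branch X m u v" and p: "p \<in> X" "lies_between m x p y"
  shows "p \<in> branch X m u v"
proof (rule ccontr)
  assume "p \<notin> branch X m u v"
  have X[simp]: "u \<in> X" "v \<in> X" "x \<in> X" "y \<in> X" "p \<in> X"
    using chain_intervalD[OF uv] x y p by (auto simp: branch_def)
  have up: "lies_between m u v p" using \<open>p \<notin> _\<close> branch_iff[of u v p] by simp
  have *: False if xy: "x \<in> X" "y \<in> X" "lies_between m x p y" "x \<in> branch X m u v"
    and le: "lies_between m (m u y v) (m u x v) v" for x y
  proof -
    define w where "w = m u x v"
    have w[simp]: "w \<in> X" using xy closed by (simp add: w_def)
    have uwv: "lies_between m u w v" "lies_between m x w v"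
      using median_between[of u x v] xy by (auto simp: w_def)
    have vwx: "lies_between m v w x" using uwv(2) xy(1) between_commute by simp
    have "lies_between m v (m u y v) y"
      using median_between[of u y v] between_commute[of y _ v] xy closed by simp
    then have vwy: "lies_between m v w y"
      using between_trans(1)[of v w "m u y v" y] le xy(1,2) closed
        between_commute[of "m u y v" w v] by (simp add: w_def)
    have "lies_between m v w (m x v y)"
      using between_median vwx vwy xy by simp
    moreover have "lies_between m v (m x v y) p"
      using gate_between xy by simp
    ultimately have vwp: "lies_between m v w p"
      using between_trans(1)[of v w "m x v y" p] xy closed by simp
    have "lies_between m w v p"
      using between_trans(2)[of u w v p] uwv up by simp
    then have "w = v"
      using between_antisym[of p w v] vwp between_commute by simp
    then show False using xy(4) by (simp add: branch_def w_def)
  qed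
  have "lies_between m u (m u x v) v" "lies_between m u (m u y v) v"
    using median_between by simp_all
  then consider "lies_between m (m u y v) (m u x v) v" | "lies_between m (m u x v) (m u y v) v"
    using chain_interval_total[OF uv, of "m u x v" "m u y v"] closed by auto
  then show False
    using *[of x y] *[of y x] x y p(2) between_commute by cases auto
qed

lemma branch_two_thirds:
  assumes "chain_interval X m u v" "x \<in> branch X m u v" "y \<in> branch X m u v" "z \<in> X"
  shows "m x y z \<in> branch X m u v" "m x z y \<in> branch X m u v" "m z x y \<in> branch X m u v"
proof -
  have "x \<in> X" "y \<in> X" using assms by (auto simp: branch_def)
  then show "m x y z \<in> branch X m u v" "m x z y \<in> branch X m u v" "m z x y \<in> branch X m u v"
    using branch_majority[OF assms(1-3)] median_between[of x y z] closed perm[of x y z] assms(4)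
    by auto
qed

lemma branch_cover:
  assumes "u \<in> X" "v \<in> X" "u \<noteq> v" "x \<in> X"
  shows "x \<in> branch X m u v \<or> x \<in> branch X m v u"
  using assms perm(3)[of u x v] by (auto simp: branch_def)

lemma branch_mono:
  assumes X: "u \<in> X" "v \<in> X" "w \<in> X" and w: "lies_between m u w v"
  shows "branch X m w v \<subseteq> branch X m u v"
  using X w between_trans(2)[of u w v] by (auto simp: branch_iff)

text \<open>Every point projects to one side of \<open>w\<close> or to the other, so \<open>w\<close> separates it from \<open>v\<close> or from \<open>u\<close>.\<close>

lemma branch_disjoint:
  assumes uv: "chain_interval X m u v" and w: "w \<in> X" "lies_between m u w v"
  shows "branch X m u w \<inter> branch X m v w = {}"
proof -
  have "lies_between m u w x \<or> lies_between m v w x" if x: "x \<in> X" for x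
  proof -
    have X[simp]: "u \<in> X" "v \<in> X" using chain_intervalD[OF uv] .
    define p where "p = m u x v"
    have p[simp]: "p \<in> X" using x closed by (simp add: p_def)
    have "lies_between m u p x" "lies_between m v p x" "lies_between m u p v"
      using median_between[of u x v] x between_commute closed by (auto simp: p_def)
    moreover have "lies_between m u w p \<or> lies_between m v w p"
      using chain_interval_total[OF uv, of w p] w \<open>lies_between m u p v\<close> between_commute by auto
    ultimately show ?thesis
      using between_trans(1)[of u w p x] between_trans(1)[of v w p x] w x by auto
  qed
  then show ?thesis
    using w chain_intervalD[OF uv] branch_iff by blast
qed

lemma branch_endpoint:
  assumes "u \<in> X" "v \<in> X" "u \<noteq> v"
  shows "u \<in> branch X m u v" "v \<notin> branch X m u v"
  using assms between_refl between_antisym[of u u v] majority[of u v]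
  by (auto simp: branch_def lies_between_def)

lemma branch_disjoint_two_points:
  assumes uv: "chain_interval X m u v"
    and two: "\<And>w. w \<in> X \<Longrightarrow> lies_between m u w v \<Longrightarrow> w = u \<or> w = v"
  shows "branch X m u v \<inter> branch X m v u = {}"
proof -
  have "m u x v = v \<or> m v x u = u" if "x \<in> X" for x
    using two[of "m u x v"] median_between(3)[of u x v] that closed chain_intervalD[OF uv]
      perm(3)[of u x v] by auto
  then show ?thesis by (auto simp: branch_def)
qed

end

section \<open>Covering uniformities\<close>

definition set_star :: "'a set \<Rightarrow> 'a set set \<Rightarrow> 'a set"
  where "set_star D \<alpha> = \<Union>{A \<in> \<alpha>. A \<inter> D \<noteq> {}}"

lemma star_subset_set_star: "x \<in> D \<Longrightarrow> star x \<alpha> \<subseteq> set_star D \<alpha>"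
  unfolding star_def set_star_def by blast

lemma set_star_refines: "cover_refines \<beta> \<alpha> \<Longrightarrow> set_star D \<beta> \<subseteq> set_star D \<alpha>"
  unfolding set_star_def cover_refines_def by fast

lemma eventually_mem_mono:
  "\<lbrakk>eventually (\<lambda>x. x \<in> A) F; A \<subseteq> B\<rbrakk> \<Longrightarrow> eventually (\<lambda>x. x \<in> B) F"
  by (erule eventually_mono) auto

text \<open>For a Cauchy filter this is the limit in the completion, the coarsest Cauchy filter above \<open>F\<close> in
the order \<open>\<le>\<close>. It is generated by the uniform neighbourhoods of the members of \<open>F\<close>.\<close>

definition round_filter :: "'a set set set \<Rightarrow> 'a filter \<Rightarrow> 'a filter"
  where "round_filter \<U> F =
    Abs_filter (\<lambda>P. \<exists>\<alpha>\<in>\<U>. \<forall>A\<in>\<alpha>. eventually (\<lambda>x. x \<in> A) F \<longrightarrow> (\<forall>x\<in>A. P x))"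

lemma ultrafilter_refinement:
  fixes F :: "'a filter"
  assumes "F \<noteq> bot"
  shows "\<exists>H\<le>F. H \<noteq> bot \<and> (\<forall>P. eventually P H \<or> eventually (\<lambda>x. \<not> P x) H)"
proof -
  define \<A> where "\<A> = {K::'a filter. K \<noteq> bot \<and> K \<le> F}"
  define r where "r = {(K, L). K \<in> \<A> \<and> L \<in> \<A> \<and> L \<le> K}"
  have r_iff: "(K, L) \<in> r \<longleftrightarrow> K \<in> \<A> \<and> L \<in> \<A> \<and> L \<le> K" for K L
    by (simp add: r_def)
  have field: "Field r = \<A>"
    by (auto simp: Field_def Domain_iff Range_iff r_iff)
  have "trans r" by (rule transI) (simp add: r_iff, blast intro: order_trans)
  moreover have "antisym r" by (rule antisymI) (simp add: r_iff)
  moreover have "refl_on \<A> r" by (rule refl_onI) (simp add: r_iff)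
  moreover have "r \<subseteq> \<A> \<times> \<A>" by (rule subrelI) (simp add: r_iff)
  ultimately have po: "Partial_order r"
    unfolding partial_order_on_def preorder_on_def field by blast
  have "\<exists>u\<in>Field r. \<forall>a\<in>C. (a, u) \<in> r" if C: "C \<in> Chains r" for C
  proof (cases "C = {}")
    case True
    have "F \<in> \<A>" using assms by (simp add: \<A>_def)
    then show ?thesis using True field by blast
  next
    case False
    have CA: "K \<in> \<A>" if "K \<in> C" for K
      using C that unfolding Chains_def r_iff by blast
    have Inf_ev: "eventually P (Inf C) \<longleftrightarrow> (\<exists>K\<in>C. eventually P K)" for P
    proof (rule eventually_Inf_base[OF False])
      fix K L assume "K \<in> C" "L \<in> C"
      then have "K \<le> L \<or> L \<le> K" using C unfolding Chains_def r_iff by blast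
      then show "\<exists>x\<in>C. x \<le> inf K L" using \<open>K \<in> C\<close> \<open>L \<in> C\<close> by (metis inf_absorb1 inf_absorb2 order_refl)
    qed
    have "\<not> eventually (\<lambda>x. False) (Inf C)"
      unfolding Inf_ev using CA by (simp add: \<A>_def trivial_limit_def)
    moreover obtain K where "K \<in> C" using False by blast
    then have "Inf C \<le> F" using CA[of K] Inf_lower2[of K C F] by (simp add: \<A>_def)
    ultimately have "Inf C \<in> \<A>" by (simp add: \<A>_def trivial_limit_def)
    then show ?thesis
      unfolding field r_iff using CA by (intro bexI[of _ "Inf C"]) (simp_all add: Inf_lower)
  qed
  then have "\<exists>H\<in>Field r. \<forall>K\<in>Field r. (H, K) \<in> r \<longrightarrow> K = H"
    by (intro Zorns_po_lemma[OF po]) simp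
  then obtain H where H: "H \<in> \<A>" and max: "\<And>K. \<lbrakk>K \<in> \<A>; K \<le> H\<rbrakk> \<Longrightarrow> K = H"
    unfolding field r_iff by blast
  have "eventually P H" if "\<not> eventually (\<lambda>x. \<not> P x) H" for P
  proof -
    have "inf H (principal {x. P x}) \<noteq> bot"
      using that by (simp add: trivial_limit_def eventually_inf_principal)
    then have "inf H (principal {x. P x}) = H"
      using H by (intro max) (simp_all add: \<A>_def le_infI1)
    moreover have "eventually P (inf H (principal {x. P x}))"
      by (simp add: eventually_inf_principal)
    ultimately show ?thesis by simp
  qed
  then show ?thesis using H unfolding \<A>_def by blast
qed

locale covering_uniformity =
  fixes X :: "'a set" and \<U> :: "'a set set set"
  assumes subset_covers: "\<U> \<subseteq> covers X"
    and nonempty: "\<U> \<noteq> {}"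
    and common_refinement:
      "\<lbrakk>\<alpha> \<in> \<U>; \<beta> \<in> \<U>\<rbrakk> \<Longrightarrow> \<exists>\<gamma>\<in>\<U>. cover_refines \<gamma> \<alpha> \<and> cover_refines \<gamma> \<beta>"
    and barycentric_refinement:
      "\<alpha> \<in> \<U> \<Longrightarrow> \<exists>\<beta>\<in>\<U>. \<forall>x\<in>X. \<exists>A\<in>\<alpha>. star x \<beta> \<subseteq> A"
begin

abbreviation "cauchy \<equiv> cauchy_filter_on X \<U>"
abbreviation "points \<equiv> completion_points X \<U>"
abbreviation "extent \<equiv> completion_extent X \<U>"
abbreviation "hat \<equiv> completion_topology X \<U>"

lemma cover_subset: "\<lbrakk>\<alpha> \<in> \<U>; A \<in> \<alpha>\<rbrakk> \<Longrightarrow> A \<subseteq> X"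
  using subset_covers by (auto simp: covers_def)

lemma cover_mem: "\<lbrakk>\<alpha> \<in> \<U>; x \<in> X\<rbrakk> \<Longrightarrow> \<exists>A\<in>\<alpha>. x \<in> A"
  using subset_covers by (auto simp: covers_def)

lemma subset_set_star: "\<lbrakk>\<alpha> \<in> \<U>; D \<subseteq> X\<rbrakk> \<Longrightarrow> D \<subseteq> set_star D \<alpha>"
  using cover_mem unfolding set_star_def by blast

text \<open>Two successive barycentric refinements: a star of a set in the second is contained in the star of a
single point in the first.\<close>

lemma star_refinement:
  assumes "\<alpha> \<in> \<U>"
  shows "\<exists>\<beta>\<in>\<U>. \<forall>B\<in>\<beta>. B \<noteq> {} \<longrightarrow> (\<exists>A\<in>\<alpha>. set_star B \<beta> \<subseteq> A)"
proof -
  obtain \<beta> where \<beta>: "\<beta> \<in> \<U>" "\<And>x. x \<in> X \<Longrightarrow> \<exists>A\<in>\<alpha>. star x \<beta> \<subseteq> A"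
    using barycentric_refinement[OF assms] by blast
  obtain \<gamma> where \<gamma>: "\<gamma> \<in> \<U>" "\<And>x. x \<in> X \<Longrightarrow> \<exists>B\<in>\<beta>. star x \<gamma> \<subseteq> B"
    using barycentric_refinement[OF \<beta>(1)] by blast
  have "\<exists>A\<in>\<alpha>. set_star C \<gamma> \<subseteq> A" if C: "C \<in> \<gamma>" "c \<in> C" for C c
  proof -
    have "set_star C \<gamma> \<subseteq> star c \<beta>"
    proof
      fix z assume "z \<in> set_star C \<gamma>"
      then obtain D y where D: "D \<in> \<gamma>" "z \<in> D" "y \<in> D" "y \<in> C"
        by (auto simp: set_star_def)
      then obtain B where B: "B \<in> \<beta>" "star y \<gamma> \<subseteq> B"
        using \<gamma>(2)[of y] cover_subset[OF \<gamma>(1)] by blast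
      then have "c \<in> B" "z \<in> B" using C D by (auto simp: star_def)
      then show "z \<in> star c \<beta>" using B(1) by (auto simp: star_def)
    qed
    then show ?thesis
      using \<beta>(2)[of c] C cover_subset[OF \<gamma>(1)] by (meson subset_trans subsetD)
  qed
  then show ?thesis using \<gamma>(1) by blast
qed

section \<open>Round filters\<close>

lemma cauchyI:
  assumes "F \<noteq> bot" "F \<le> principal X" "\<And>\<alpha>. \<alpha> \<in> \<U> \<Longrightarrow> \<exists>A\<in>\<alpha>. eventually (\<lambda>x. x \<in> A) F"
  shows "cauchy F"
  using assms by (auto simp: cauchy_filter_on_def)

lemma cauchy_cover: "\<lbrakk>cauchy F; \<alpha> \<in> \<U>\<rbrakk> \<Longrightarrow> \<exists>A\<in>\<alpha>. eventually (\<lambda>x. x \<in> A) F"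
  by (auto simp: cauchy_filter_on_def)

lemma cauchy_carrier: "cauchy F \<Longrightarrow> eventually (\<lambda>x. x \<in> X) F"
  by (auto simp: cauchy_filter_on_def le_principal)

lemma cauchy_meets:
  assumes "cauchy F" "eventually (\<lambda>x. x \<in> A) F" "eventually (\<lambda>x. x \<in> B) F"
  shows "A \<inter> B \<inter> X \<noteq> {}"
proof -
  have "eventually (\<lambda>x. x \<in> A \<inter> B \<inter> X) F"
    using assms(2,3) cauchy_carrier[OF assms(1)] by eventually_elim auto
  then have "A \<inter> B \<inter> X = {} \<Longrightarrow> eventually (\<lambda>x. False) F" by simp
  then show ?thesis using assms(1) by (auto simp only: cauchy_filter_on_def trivial_limit_def)
qed

lemma cauchy_coarser: "\<lbrakk>cauchy F; F' \<le> F; F' \<noteq> bot\<rbrakk> \<Longrightarrow> cauchy F'"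
  by (meson cauchy_filter_on_def filter_leD order_trans)

lemma eventually_round:
  "eventually P (round_filter \<U> F) \<longleftrightarrow>
    (\<exists>\<alpha>\<in>\<U>. \<forall>A\<in>\<alpha>. eventually (\<lambda>x. x \<in> A) F \<longrightarrow> (\<forall>x\<in>A. P x))"
  unfolding round_filter_def
proof (rule eventually_Abs_filter, rule is_filter.intro)
  show "\<exists>\<alpha>\<in>\<U>. \<forall>A\<in>\<alpha>. (\<forall>\<^sub>F x in F. x \<in> A) \<longrightarrow> (\<forall>x\<in>A. True)"
    using nonempty by auto
next
  fix P Q
  assume "\<exists>\<alpha>\<in>\<U>. \<forall>A\<in>\<alpha>. (\<forall>\<^sub>F x in F. x \<in> A) \<longrightarrow> (\<forall>x\<in>A. P x)"
    and "\<exists>\<alpha>\<in>\<U>. \<forall>A\<in>\<alpha>. (\<forall>\<^sub>F x in F. x \<in> A) \<longrightarrow> (\<forall>x\<in>A. Q x)"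
  then obtain \<alpha> \<beta> where \<alpha>: "\<alpha> \<in> \<U>" "\<And>A. A\<in>\<alpha> \<Longrightarrow> (\<forall>\<^sub>F x in F. x \<in> A) \<Longrightarrow> (\<forall>x\<in>A. P x)"
    and \<beta>: "\<beta> \<in> \<U>" "\<And>A. A\<in>\<beta> \<Longrightarrow> (\<forall>\<^sub>F x in F. x \<in> A) \<Longrightarrow> (\<forall>x\<in>A. Q x)"
    by (elim bexE) auto
  obtain \<gamma> where \<gamma>: "\<gamma> \<in> \<U>" "cover_refines \<gamma> \<alpha>" "cover_refines \<gamma> \<beta>"
    using common_refinement[OF \<alpha>(1) \<beta>(1)] by blast
  have "P x \<and> Q x" if C: "C \<in> \<gamma>" "\<forall>\<^sub>F x in F. x \<in> C" "x \<in> C" for C x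
  proof -
    obtain A where A: "A \<in> \<alpha>" "C \<subseteq> A"
      using \<gamma>(2) C(1) by (auto simp: cover_refines_def)
    obtain B where B: "B \<in> \<beta>" "C \<subseteq> B"
      using \<gamma>(3) C(1) by (auto simp: cover_refines_def)
    have "\<forall>\<^sub>F x in F. x \<in> A" "\<forall>\<^sub>F x in F. x \<in> B"
      using eventually_mem_mono[OF C(2)] A(2) B(2) by simp_all
    then show ?thesis using \<alpha>(2)[OF A(1)] \<beta>(2)[OF B(1)] A(2) B(2) C(3) by auto
  qed
  then show "\<exists>\<alpha>\<in>\<U>. \<forall>A\<in>\<alpha>. (\<forall>\<^sub>F x in F. x \<in> A) \<longrightarrow> (\<forall>x\<in>A. P x \<and> Q x)"
    using \<gamma>(1) by blast
next
  fix P Q :: "'a \<Rightarrow> bool"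
  assume "\<forall>x. P x \<longrightarrow> Q x" "\<exists>\<alpha>\<in>\<U>. \<forall>A\<in>\<alpha>. (\<forall>\<^sub>F x in F. x \<in> A) \<longrightarrow> (\<forall>x\<in>A. P x)"
  then show "\<exists>\<alpha>\<in>\<U>. \<forall>A\<in>\<alpha>. (\<forall>\<^sub>F x in F. x \<in> A) \<longrightarrow> (\<forall>x\<in>A. Q x)" by blast
qed

text \<open>This and \<open>round_intro\<close> identify the members of the round filter as the sets that contain a uniform
thickening of a member of \<open>F\<close>.\<close>

lemma round_star:
  assumes F: "cauchy F" and P: "eventually P (round_filter \<U> F)"
  shows "\<exists>D\<subseteq>X. \<exists>\<beta>\<in>\<U>. eventually (\<lambda>x. x \<in> D) F \<and> (\<forall>x\<in>set_star D \<beta>. P x)"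
proof -
  obtain \<alpha> where \<alpha>: "\<alpha> \<in> \<U>" "\<And>A x. \<lbrakk>A \<in> \<alpha>; eventually (\<lambda>x. x \<in> A) F; x \<in> A\<rbrakk> \<Longrightarrow> P x"
    using P unfolding eventually_round by blast
  obtain \<beta> where \<beta>: "\<beta> \<in> \<U>" "\<And>B. \<lbrakk>B \<in> \<beta>; B \<noteq> {}\<rbrakk> \<Longrightarrow> \<exists>A\<in>\<alpha>. set_star B \<beta> \<subseteq> A"
    using star_refinement[OF \<alpha>(1)] by blast
  obtain D where D: "D \<in> \<beta>" "eventually (\<lambda>x. x \<in> D) F"
    using cauchy_cover[OF F \<beta>(1)] by blast
  have "D \<noteq> {}" using cauchy_meets[OF F D(2) D(2)] by blast
  then obtain A where A: "A \<in> \<alpha>" "set_star D \<beta> \<subseteq> A" using \<beta>(2) D(1) by blast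
  have DX: "D \<subseteq> X" using cover_subset \<beta>(1) D(1) .
  have "eventually (\<lambda>x. x \<in> A) F"
    using D(2) by (rule eventually_mono) (use subset_set_star[OF \<beta>(1) DX] A(2) in blast)
  then show ?thesis using \<alpha>(2) A D(2) \<beta>(1) DX by blast
qed

lemma round_intro:
  assumes F: "cauchy F" and D: "eventually (\<lambda>x. x \<in> D) F" "\<beta> \<in> \<U>" "\<And>x. x \<in> set_star D \<beta> \<Longrightarrow> P x"
  shows "eventually P (round_filter \<U> F)"
  unfolding eventually_round
proof (intro bexI[of _ \<beta>] ballI impI)
  fix A x assume "A \<in> \<beta>" "eventually (\<lambda>x. x \<in> A) F" "x \<in> A"
  moreover have "A \<inter> D \<noteq> {}" using cauchy_meets[OF F calculation(2) D(1)] by blast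
  ultimately show "P x" using D(3) by (auto simp: set_star_def)
qed (rule D(2))

lemma round_coarsest:
  assumes "cauchy F'" "F \<le> F'"
  shows "F' \<le> round_filter \<U> F"
proof (rule filter_leI)
  fix P assume "eventually P (round_filter \<U> F)"
  then obtain \<alpha> where \<alpha>: "\<alpha> \<in> \<U>" "\<And>A x. \<lbrakk>A \<in> \<alpha>; eventually (\<lambda>x. x \<in> A) F; x \<in> A\<rbrakk> \<Longrightarrow> P x"
    unfolding eventually_round by blast
  obtain A where A: "A \<in> \<alpha>" "eventually (\<lambda>x. x \<in> A) F'"
    using cauchy_cover[OF assms(1) \<alpha>(1)] by blast
  then have "eventually (\<lambda>x. x \<in> A) F" using assms(2) by (simp add: filter_leD)
  then show "eventually P F'"
    using A \<alpha>(2) by (auto elim!: eventually_mono)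
qed

lemma cauchy_round:
  assumes F: "cauchy F"
  shows "cauchy (round_filter \<U> F)"
proof (rule cauchyI)
  have le: "F \<le> round_filter \<U> F" using round_coarsest[OF F] by simp
  then show "round_filter \<U> F \<noteq> bot"
    using F unfolding cauchy_filter_on_def by (metis bot_unique)
  obtain \<alpha> where "\<alpha> \<in> \<U>" using nonempty by blast
  then show "round_filter \<U> F \<le> principal X"
    using cover_subset unfolding le_principal eventually_round by blast
  fix \<alpha> assume \<alpha>: "\<alpha> \<in> \<U>"
  obtain \<beta> where \<beta>: "\<beta> \<in> \<U>" "\<And>B. \<lbrakk>B \<in> \<beta>; B \<noteq> {}\<rbrakk> \<Longrightarrow> \<exists>A\<in>\<alpha>. set_star B \<beta> \<subseteq> A"
    using star_refinement[OF \<alpha>] by blast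
  obtain D where D: "D \<in> \<beta>" "eventually (\<lambda>x. x \<in> D) F"
    using cauchy_cover[OF F \<beta>(1)] by blast
  have "D \<noteq> {}" using cauchy_meets[OF F D(2) D(2)] by blast
  then obtain A where A: "A \<in> \<alpha>" "set_star D \<beta> \<subseteq> A" using \<beta>(2) D(1) by blast
  then show "\<exists>A\<in>\<alpha>. eventually (\<lambda>x. x \<in> A) (round_filter \<U> F)"
    using round_intro[OF F D(2) \<beta>(1), of "\<lambda>x. x \<in> A"] by blast
qed

lemma round_in_points:
  assumes F: "cauchy F"
  shows "round_filter \<U> F \<in> points"
proof -
  have "F \<le> round_filter \<U> F" using round_coarsest[OF F] by simp
  then have "F' = round_filter \<U> F" if "cauchy F'" "round_filter \<U> F \<le> F'" for F'
    using that round_coarsest[of F' F] by (meson order_antisym order_trans)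
  then show ?thesis
    using cauchy_round[OF F] by (simp add: completion_points_def)
qed

lemma points_cauchy: "F \<in> points \<Longrightarrow> cauchy F"
  by (simp add: completion_points_def)

text \<open>Limits in the completion are recognised by this rule: any minimal Cauchy filter coarser than \<open>F\<close> is
the limit of \<open>F\<close>.\<close>

lemma round_unique:
  assumes "F' \<in> points" "F \<le> F'" "F \<noteq> bot"
  shows "round_filter \<U> F = F'"
proof -
  have "cauchy F" using cauchy_coarser points_cauchy assms by blast
  then show ?thesis
    using round_coarsest[of F' F] cauchy_round[of F] assms by (simp add: completion_points_def)
qed

lemma round_point: "F \<in> points \<Longrightarrow> round_filter \<U> F = F"
  using round_unique[of F F] by (simp add: completion_points_def cauchy_filter_on_def)

section \<open>The topology of the completion\<close>

lemma topspace_hat: "topspace hat = points"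
  using topspace_completion_topology[OF common_refinement nonempty] .

text \<open>A minimal Cauchy filter equals its own round filter, so each \<open>A \<in> F\<close> contains all \<open>F\<close>-large members
of some uniform cover, and the star of \<open>F\<close> in the induced cover lies in the extent of \<open>A\<close>. Hence the
extents of all sets, not only of uniformly large ones, form a base.\<close>

lemma openin_hat:
  "openin hat W \<longleftrightarrow>
    W \<subseteq> points \<and> (\<forall>F\<in>W. \<exists>A. eventually (\<lambda>x. x \<in> A) F \<and> extent A \<subseteq> W)"
proof -
  have 1: "\<exists>\<beta>\<in>completion_uniformity X \<U>. star F \<beta> \<subseteq> extent A"
    if F: "F \<in> points" "eventually (\<lambda>x. x \<in> A) F" for F A
  proof -
    have "eventually (\<lambda>x. x \<in> A) (round_filter \<U> F)" using F round_point by simp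
    then obtain \<alpha> where \<alpha>: "\<alpha> \<in> \<U>" "\<And>C. \<lbrakk>C \<in> \<alpha>; eventually (\<lambda>x. x \<in> C) F\<rbrakk> \<Longrightarrow> C \<subseteq> A"
      unfolding eventually_round by blast
    have "extent ` \<alpha> \<in> completion_uniformity X \<U>"
    proof -
      have "\<Union>(extent ` \<alpha>) = points"
        using cauchy_cover[OF points_cauchy \<alpha>(1)] by (auto simp: completion_extent_def)
      then show ?thesis
        using \<alpha>(1) unfolding completion_uniformity_def covers_def cover_refines_def by blast
    qed
    moreover have "star F (extent ` \<alpha>) \<subseteq> extent A"
      using \<alpha>(2) by (auto simp: star_def completion_extent_def elim!: eventually_mono)
    ultimately show ?thesis by blast
  qed
  have 2: "\<exists>A. eventually (\<lambda>x. x \<in> A) F \<and> extent A \<subseteq> star F \<beta>"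
    if F: "F \<in> points" "\<beta> \<in> completion_uniformity X \<U>" for F \<beta>
  proof -
    obtain \<alpha> where \<alpha>: "\<alpha> \<in> \<U>" "cover_refines (extent ` \<alpha>) \<beta>"
      using F(2) by (auto simp: completion_uniformity_def)
    obtain A where A: "A \<in> \<alpha>" "eventually (\<lambda>x. x \<in> A) F"
      using cauchy_cover[OF points_cauchy \<alpha>(1)] F(1) by blast
    obtain B where B: "B \<in> \<beta>" "extent A \<subseteq> B"
      using \<alpha>(2) A(1) by (auto simp: cover_refines_def)
    have "F \<in> extent A" using F(1) A(2) by (simp add: completion_extent_def)
    then have "extent A \<subseteq> star F \<beta>" using B by (auto simp: star_def)
    then show ?thesis using A(2) by blast
  qed
  have "openin hat W \<longleftrightarrow>
      W \<subseteq> points \<and> (\<forall>F\<in>W. \<exists>\<beta>\<in>completion_uniformity X \<U>. star F \<beta> \<subseteq> W)"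
    unfolding completion_topology_def
    by (rule openin_uniform_topology) (rule completion_uniformity_refine[OF common_refinement])
  then show ?thesis
    using 1 2 by (meson subset_trans subsetD)
qed

lemma openin_extent: "openin hat (extent A)"
  unfolding openin_hat by (auto simp: completion_extent_def)

text \<open>If every uniform cover had a member common to \<open>F\<close> and \<open>F'\<close>, their supremum would be a Cauchy filter,
and minimality would make both equal to it.\<close>

lemma Hausdorff_hat: "Hausdorff_space hat"
  unfolding Hausdorff_space_def topspace_hat
proof (intro allI impI, elim conjE)
  fix F F' assume F: "F \<in> points" "F' \<in> points" "F \<noteq> F'"
  have "sup F F' = F \<and> sup F F' = F'" if "cauchy (sup F F')"
    using F(1,2) that unfolding completion_points_def by simp
  then have "\<not> cauchy (sup F F')" using F(3) by metis
  moreover have "sup F F' \<noteq> bot" "sup F F' \<le> principal X"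
    using points_cauchy[OF F(1)] points_cauchy[OF F(2)]
    by (auto simp only: cauchy_filter_on_def sup_eq_bot_iff sup.bounded_iff)
  ultimately obtain \<alpha> where \<alpha>: "\<alpha> \<in> \<U>"
    "\<And>A. A \<in> \<alpha> \<Longrightarrow> \<not> (eventually (\<lambda>x. x \<in> A) F \<and> eventually (\<lambda>x. x \<in> A) F')"
    using cauchyI[of "sup F F'"] unfolding eventually_sup by metis
  obtain \<beta> where \<beta>: "\<beta> \<in> \<U>" "\<And>x. x \<in> X \<Longrightarrow> \<exists>A\<in>\<alpha>. star x \<beta> \<subseteq> A"
    using barycentric_refinement[OF \<alpha>(1)] by blast
  obtain B where B: "B \<in> \<beta>" "eventually (\<lambda>x. x \<in> B) F"
    using cauchy_cover[OF points_cauchy[OF F(1)] \<beta>(1)] by blast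
  obtain B' where B': "B' \<in> \<beta>" "eventually (\<lambda>x. x \<in> B') F'"
    using cauchy_cover[OF points_cauchy[OF F(2)] \<beta>(1)] by blast
  have "B \<inter> B' = {}"
  proof (rule ccontr)
    assume "B \<inter> B' \<noteq> {}"
    then obtain x where x: "x \<in> B" "x \<in> B'" by blast
    then obtain A where "A \<in> \<alpha>" "star x \<beta> \<subseteq> A"
      using \<beta>(2)[of x] cover_subset[OF \<beta>(1) B(1)] by blast
    moreover have "B \<subseteq> A" "B' \<subseteq> A" using x B B' calculation(2) by (auto simp: star_def)
    ultimately show False
      using \<alpha>(2)[of A] eventually_mem_mono[OF B(2)] eventually_mem_mono[OF B'(2)] by simp
  qed
  then have "disjnt (extent B) (extent B')"
    using cauchy_meets[OF points_cauchy, of _ B B'] by (auto simp: disjnt_iff completion_extent_def)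
  then show "\<exists>U V. openin hat U \<and> openin hat V \<and> F \<in> U \<and> F' \<in> V \<and> disjnt U V"
    using openin_extent[of B] openin_extent[of B'] B B' F by (auto simp: completion_extent_def)
qed

text \<open>Around each point \<open>F\<close> choose \<open>D F \<in> F\<close> with a thickening whose extent lies in a member of the given
open cover. If no finitely many of the sets \<open>D F\<close> covered \<open>X\<close>, some ultrafilter would avoid them all;
but its limit \<open>F\<close> is a point of the completion, and \<open>D F\<close> belongs to \<open>F\<close> and hence to the ultrafilter.
So finitely many sets \<open>D F\<close> cover \<open>X\<close>, and the thickenings turn this into a finite subcover.\<close>

lemma compact_hat:
  assumes ultra: "\<And>H. \<lbrakk>H \<noteq> bot; H \<le> principal X; \<And>P. eventually P H \<or> eventually (\<lambda>x. \<not> P x) H\<rbrakk>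
    \<Longrightarrow> cauchy H"
  shows "compact_space hat"
  unfolding compact_space_alt topspace_hat
proof (intro allI impI, elim conjE)
  fix \<W> assume W: "\<forall>W\<in>\<W>. openin hat W" "points \<subseteq> \<Union>\<W>"
  have "\<exists>D \<beta> W. D \<subseteq> X \<and> \<beta> \<in> \<U> \<and> W \<in> \<W> \<and> eventually (\<lambda>x. x \<in> D) F \<and> extent (set_star D \<beta>) \<subseteq> W"
    if F: "F \<in> points" for F
  proof -
    obtain V where V: "V \<in> \<W>" "F \<in> V" using W(2) F by blast
    then have "openin hat V" using W(1) by blast
    then obtain A where A: "eventually (\<lambda>x. x \<in> A) F" "extent A \<subseteq> V"
      using V(2) unfolding openin_hat by blast
    have "eventually (\<lambda>x. x \<in> A) (round_filter \<U> F)" using A(1) round_point[OF F] by simp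
    then obtain D \<beta> where D: "D \<subseteq> X" "\<beta> \<in> \<U>" "eventually (\<lambda>x. x \<in> D) F" "set_star D \<beta> \<subseteq> A"
      using round_star[OF points_cauchy[OF F], of "\<lambda>x. x \<in> A"] by blast
    have "extent (set_star D \<beta>) \<subseteq> extent A"
      using eventually_mem_mono[OF _ D(4)] by (auto simp: completion_extent_def)
    then have "extent (set_star D \<beta>) \<subseteq> V" using A(2) by blast
    then show ?thesis using D(1,2,3) V(1) by blast
  qed
  then obtain D \<beta> W where D: "\<And>F. F \<in> points \<Longrightarrow> D F \<subseteq> X \<and> \<beta> F \<in> \<U> \<and> W F \<in> \<W> \<and>
      eventually (\<lambda>x. x \<in> D F) F \<and> extent (set_star (D F) (\<beta> F)) \<subseteq> W F"
    by metis
  have "\<exists>\<F>\<subseteq>points. finite \<F> \<and> X \<subseteq> (\<Union>F\<in>\<F>. D F)"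
  proof (rule ccontr)
    assume no: "\<not> ?thesis"
    \<comment> \<open>The filter generated by the complements of the finite unions of sets \<open>D F\<close>.\<close>
    define F0 where "F0 = (INF \<F>\<in>{\<F>. \<F> \<subseteq> points \<and> finite \<F>}. principal (X - (\<Union>F\<in>\<F>. D F)))"
    have ev: "eventually P F0 \<longleftrightarrow>
        (\<exists>\<F>\<in>{\<F>. \<F> \<subseteq> points \<and> finite \<F>}. eventually P (principal (X - (\<Union>F\<in>\<F>. D F))))" for P
      unfolding F0_def
    proof (rule eventually_INF_base)
      fix \<F> \<G> assume "\<F> \<in> {\<F>. \<F> \<subseteq> points \<and> finite \<F>}" "\<G> \<in> {\<F>. \<F> \<subseteq> points \<and> finite \<F>}"
      then show "\<exists>\<H>\<in>{\<F>. \<F> \<subseteq> points \<and> finite \<F>}. principal (X - (\<Union>F\<in>\<H>. D F)) \<le>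
          inf (principal (X - (\<Union>F\<in>\<F>. D F))) (principal (X - (\<Union>F\<in>\<G>. D F)))"
        by (intro bexI[of _ "\<F> \<union> \<G>"]) auto
    qed auto
    have "F0 \<noteq> bot" using no by (auto simp: trivial_limit_def ev eventually_principal)
    then obtain H where H: "H \<le> F0" "H \<noteq> bot" "\<And>P. eventually P H \<or> eventually (\<lambda>x. \<not> P x) H"
      using ultrafilter_refinement by blast
    have "eventually (\<lambda>x. x \<in> X) F0"
      unfolding ev by (intro bexI[of _ "{}"]) (auto simp: eventually_principal)
    then have "cauchy H" using ultra[OF H(2) _ H(3)] filter_leD[OF H(1)] by (simp add: le_principal)
    then have R: "round_filter \<U> H \<in> points" by (rule round_in_points)
    let ?D = "D (round_filter \<U> H)"
    have "eventually (\<lambda>x. x \<in> ?D) (round_filter \<U> H)" using D[OF R] by blast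
    then have 1: "eventually (\<lambda>x. x \<in> ?D) H"
      using round_coarsest[OF \<open>cauchy H\<close> order_refl] filter_leD[of H _ "\<lambda>x. x \<in> ?D"] by simp
    have "eventually (\<lambda>x. x \<notin> ?D) F0"
      unfolding ev using R by (intro bexI[of _ "{round_filter \<U> H}"]) (auto simp: eventually_principal)
    then have "eventually (\<lambda>x. x \<notin> ?D) H" using filter_leD[OF H(1)] by simp
    then have "eventually (\<lambda>x. False) H" using 1 by eventually_elim simp
    then show False using H(2) by (simp add: trivial_limit_def)
  qed
  then obtain \<F> where \<F>: "\<F> \<subseteq> points" "finite \<F>" "X \<subseteq> (\<Union>F\<in>\<F>. D F)" by blast
  have "\<exists>F\<in>\<F>. K \<in> W F" if K: "K \<in> points" for K
  proof -
    have "\<exists>\<gamma>\<in>\<U>. \<forall>F\<in>\<F>. cover_refines \<gamma> (\<beta> F)"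
      using \<F>(2,1)
    proof (induction \<F> rule: finite_induct)
      case empty
      then show ?case using nonempty by blast
    next
      case (insert F \<F>)
      then obtain \<gamma> where \<gamma>: "\<gamma> \<in> \<U>" "\<forall>F\<in>\<F>. cover_refines \<gamma> (\<beta> F)" by blast
      obtain \<delta> where "\<delta> \<in> \<U>" "cover_refines \<delta> \<gamma>" "cover_refines \<delta> (\<beta> F)"
        using common_refinement \<gamma>(1) D[of F] insert.prems by blast
      then show ?case using \<gamma>(2) cover_refines_trans by blast
    qed
    then obtain \<gamma> where \<gamma>: "\<gamma> \<in> \<U>" "\<And>F. F\<in>\<F> \<Longrightarrow> cover_refines \<gamma> (\<beta> F)" by blast
    obtain C where C: "C \<in> \<gamma>" "eventually (\<lambda>x. x \<in> C) K"
      using cauchy_cover[OF points_cauchy[OF K] \<gamma>(1)] by blast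
    obtain x where x: "x \<in> C" using cauchy_meets[OF points_cauchy[OF K] C(2) C(2)] by blast
    then obtain F where F: "F \<in> \<F>" "x \<in> D F" using \<F>(3) cover_subset[OF \<gamma>(1) C(1)] by blast
    then have "C \<subseteq> set_star (D F) \<gamma>" using C(1) x by (auto simp: set_star_def)
    also have "\<dots> \<subseteq> set_star (D F) (\<beta> F)" using \<gamma>(2) F(1) by (simp add: set_star_refines)
    finally have "K \<in> extent (set_star (D F) (\<beta> F))"
      using eventually_mem_mono[OF C(2)] K by (simp add: completion_extent_def)
    moreover have "F \<in> points" using F(1) \<F>(1) by blast
    ultimately show ?thesis using D[of F] F(1) by blast
  qed
  then have "finite (W ` \<F>) \<and> W ` \<F> \<subseteq> \<W> \<and> points \<subseteq> \<Union>(W ` \<F>)"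
    using \<F>(1,2) D by auto
  then show "\<exists>\<F>. finite \<F> \<and> \<F> \<subseteq> \<W> \<and> points \<subseteq> \<Union>\<F>" by blast
qed

section \<open>The canonical map into the completion\<close>

abbreviation "\<tau> \<equiv> uniform_topology X \<U>"
abbreviation "\<iota> \<equiv> completion_map X \<U>"

lemma openin_\<tau>: "openin \<tau> W \<longleftrightarrow> W \<subseteq> X \<and> (\<forall>x\<in>W. \<exists>\<alpha>\<in>\<U>. star x \<alpha> \<subseteq> W)"
  by (rule openin_uniform_topology[OF common_refinement])

lemma topspace_\<tau>: "topspace \<tau> = X"
  by (rule topspace_uniform_topology[OF common_refinement nonempty subset_covers])

lemma eventually_\<iota>:
  assumes x: "x \<in> X"
  shows "eventually P (\<iota> x) \<longleftrightarrow> (\<exists>\<alpha>\<in>\<U>. \<forall>y\<in>star x \<alpha>. P y)"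
proof
  assume "eventually P (\<iota> x)"
  then obtain S where "openin \<tau> S" "x \<in> S" "\<forall>y\<in>S. P y"
    using x by (auto simp: completion_map_def eventually_nhdsin topspace_\<tau>)
  then show "\<exists>\<alpha>\<in>\<U>. \<forall>y\<in>star x \<alpha>. P y" unfolding openin_\<tau> by blast
next
  assume "\<exists>\<alpha>\<in>\<U>. \<forall>y\<in>star x \<alpha>. P y"
  then obtain \<alpha> where \<alpha>: "\<alpha> \<in> \<U>" "\<forall>y\<in>star x \<alpha>. P y" by blast
  \<comment> \<open>The interior of \<open>star x \<alpha>\<close>.\<close>
  define S where "S = {y\<in>X. \<exists>\<beta>\<in>\<U>. star y \<beta> \<subseteq> star x \<alpha>}"
  have "\<exists>\<gamma>\<in>\<U>. star y \<gamma> \<subseteq> S" if y: "y \<in> S" for y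
  proof -
    obtain \<beta> where \<beta>: "\<beta> \<in> \<U>" "star y \<beta> \<subseteq> star x \<alpha>" using y by (auto simp: S_def)
    obtain \<gamma> where \<gamma>: "\<gamma> \<in> \<U>" "\<And>z. z \<in> X \<Longrightarrow> \<exists>B\<in>\<beta>. star z \<gamma> \<subseteq> B"
      using barycentric_refinement[OF \<beta>(1)] by blast
    have "z \<in> S" if z: "z \<in> star y \<gamma>" for z
    proof -
      have zX: "z \<in> X" "y \<in> star z \<gamma>" using z cover_subset[OF \<gamma>(1)] by (auto simp: star_def)
      then obtain B where B: "B \<in> \<beta>" "star z \<gamma> \<subseteq> B" using \<gamma>(2) by blast
      then have "B \<subseteq> star y \<beta>" using zX by (auto simp: star_def)
      then show ?thesis using B \<beta>(2) \<gamma>(1) zX(1) by (auto simp: S_def)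
    qed
    then show ?thesis using \<gamma>(1) by blast
  qed
  then have "openin \<tau> S" unfolding openin_\<tau> by (auto simp: S_def)
  moreover have "x \<in> S" using x \<alpha>(1) unfolding S_def by blast
  moreover have "P y" if y: "y \<in> S" for y
  proof -
    obtain \<beta> where "\<beta> \<in> \<U>" "star y \<beta> \<subseteq> star x \<alpha>" "y \<in> X" using y by (auto simp: S_def)
    then show ?thesis using \<alpha>(2) cover_mem[of \<beta> y] by (auto simp: star_def)
  qed
  ultimately show "eventually P (\<iota> x)"
    by (auto simp: completion_map_def eventually_nhdsin)
qed

lemma eventually_\<iota>_mem: "\<lbrakk>x \<in> X; eventually P (\<iota> x)\<rbrakk> \<Longrightarrow> P x"
  using cover_mem by (fastforce simp: eventually_\<iota> star_def)

text \<open>A Cauchy filter converges to a point that belongs to all its members, since its uniformly small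
members lie in the stars of that point. With \<open>round_eq_\<iota>\<close> this shows that the
extended operations agree with the given ones on \<open>X\<close>.\<close>

lemma cauchy_le_\<iota>:
  assumes F: "cauchy F" and p: "p \<in> X" "\<And>A. eventually (\<lambda>x. x \<in> A) F \<Longrightarrow> p \<in> A"
  shows "F \<le> \<iota> p"
proof (rule filter_leI)
  fix P assume "eventually P (\<iota> p)"
  then obtain \<alpha> where \<alpha>: "\<alpha> \<in> \<U>" "\<forall>y\<in>star p \<alpha>. P y" using p(1) eventually_\<iota> by blast
  obtain A where A: "A \<in> \<alpha>" "eventually (\<lambda>x. x \<in> A) F"
    using cauchy_cover[OF F \<alpha>(1)] by blast
  then have "A \<subseteq> star p \<alpha>" using p(2) by (auto simp: star_def)
  then show "eventually P F" using A(2) \<alpha>(2) by (auto elim!: eventually_mono)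
qed

lemma \<iota>_in_points:
  assumes x: "x \<in> X"
  shows "\<iota> x \<in> points"
proof -
  have "cauchy (\<iota> x)"
  proof (rule cauchyI)
    show "\<iota> x \<noteq> bot" using eventually_\<iota>_mem[OF x] by (auto simp: trivial_limit_def)
    obtain \<alpha> where "\<alpha> \<in> \<U>" using nonempty by blast
    then show "\<iota> x \<le> principal X"
      unfolding le_principal eventually_\<iota>[OF x] using cover_subset by (auto simp: star_def)
    fix \<alpha> assume "\<alpha> \<in> \<U>"
    then obtain \<beta> A where "\<beta> \<in> \<U>" "A \<in> \<alpha>" "star x \<beta> \<subseteq> A"
      using barycentric_refinement[of \<alpha>] x by blast
    then show "\<exists>A\<in>\<alpha>. eventually (\<lambda>x. x \<in> A) (\<iota> x)"
      unfolding eventually_\<iota>[OF x] by blast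
  qed
  moreover have "F = \<iota> x" if F: "cauchy F" "\<iota> x \<le> F" for F
  proof (rule order_antisym[OF _ F(2)])
    show "F \<le> \<iota> x"
    proof (rule cauchy_le_\<iota>[OF F(1) x])
      fix A assume "eventually (\<lambda>x. x \<in> A) F"
      then show "x \<in> A" using filter_leD[OF F(2)] eventually_\<iota>_mem[OF x] by blast
    qed
  qed
  ultimately show ?thesis by (simp add: completion_points_def)
qed

lemma round_eq_\<iota>:
  assumes F: "cauchy F" and p: "p \<in> X" "\<And>A. eventually (\<lambda>x. x \<in> A) F \<Longrightarrow> p \<in> A"
  shows "round_filter \<U> F = \<iota> p"
  using round_unique[OF \<iota>_in_points[OF p(1)] cauchy_le_\<iota>[OF assms]] F
  by (simp add: cauchy_filter_on_def)

lemma openin_\<iota>_vimage: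
  assumes "openin hat W"
  shows "openin \<tau> {x\<in>X. \<iota> x \<in> W}"
proof -
  have "\<exists>\<alpha>\<in>\<U>. star x \<alpha> \<subseteq> {x\<in>X. \<iota> x \<in> W}" if x: "x \<in> X" "\<iota> x \<in> W" for x
  proof -
    obtain A where A: "eventually (\<lambda>x. x \<in> A) (\<iota> x)" "extent A \<subseteq> W"
      using assms x(2) unfolding openin_hat by blast
    then obtain S where S: "openin \<tau> S" "x \<in> S" "S \<subseteq> A"
      using x(1) by (auto simp: completion_map_def eventually_nhdsin topspace_\<tau>)
    have "eventually (\<lambda>x. x \<in> A) (\<iota> y)" if "y \<in> S" for y
      using S that unfolding completion_map_def eventually_nhdsin by blast
    then have "\<iota> y \<in> W" if "y \<in> S" for y
      using A(2) that \<iota>_in_points[of y] S(1) unfolding openin_\<tau> by (auto simp: completion_extent_def)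
    then show ?thesis using S unfolding openin_\<tau> by blast
  qed
  then show ?thesis unfolding openin_\<tau> by auto
qed

lemma continuous_\<iota>: "continuous_map \<tau> hat \<iota>"
  unfolding continuous_map_def topspace_\<tau> topspace_hat
  using \<iota>_in_points openin_\<iota>_vimage by auto

lemma embedding_\<iota>:
  assumes inj: "inj_on \<iota> X"
  shows "embedding_map \<tau> hat \<iota>"
proof -
  have "open_map \<tau> (subtopology hat (\<iota> ` X)) \<iota>"
    unfolding open_map_def
  proof (intro allI impI)
    fix U assume U: "openin \<tau> U"
    then have UX: "U \<subseteq> X" by (simp add: openin_\<tau>)
    have "\<iota> ` U = extent U \<inter> \<iota> ` X"
    proof
      have "eventually (\<lambda>y. y \<in> U) (\<iota> x)" if "x \<in> U" for x
        using U that unfolding completion_map_def eventually_nhdsin by blast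
      then show "\<iota> ` U \<subseteq> extent U \<inter> \<iota> ` X"
        using UX \<iota>_in_points by (auto simp: completion_extent_def)
      show "extent U \<inter> \<iota> ` X \<subseteq> \<iota> ` U"
        using eventually_\<iota>_mem by (auto simp: completion_extent_def)
    qed
    then show "openin (subtopology hat (\<iota> ` X)) (\<iota> ` U)"
      using openin_extent[of U] unfolding openin_subtopology by blast
  qed
  moreover have "continuous_map \<tau> (subtopology hat (\<iota> ` X)) \<iota>"
    using continuous_\<iota> by (simp add: continuous_map_in_subtopology topspace_\<tau>)
  moreover have "topspace (subtopology hat (\<iota> ` X)) = \<iota> ` X"
    using \<iota>_in_points by (auto simp: topspace_hat)
  ultimately show ?thesis
    unfolding embedding_map_def topspace_\<tau>
    by (intro bijective_open_imp_homeomorphic_map) (auto simp: topspace_\<tau> inj)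
qed

lemma dense_\<iota>: "Abstract_Topology.closure_of hat (\<iota> ` X) = points"
proof
  show "Abstract_Topology.closure_of hat (\<iota> ` X) \<subseteq> points"
    using closure_of_subset_topspace[of hat] topspace_hat by blast
  have "\<exists>y. y \<in> \<iota> ` X \<and> y \<in> W" if F: "F \<in> points" "F \<in> W" "openin hat W" for F W
  proof -
    obtain A where A: "eventually (\<lambda>x. x \<in> A) F" "extent A \<subseteq> W"
      using F unfolding openin_hat by blast
    then have "eventually (\<lambda>x. x \<in> A) (round_filter \<U> F)" using round_point[OF F(1)] by simp
    then obtain D \<beta> where D: "D \<subseteq> X" "\<beta> \<in> \<U>" "eventually (\<lambda>x. x \<in> D) F" "set_star D \<beta> \<subseteq> A"
      using round_star[OF points_cauchy[OF F(1)], of "\<lambda>x. x \<in> A"] by blast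
    obtain x where x: "x \<in> D" "x \<in> X"
      using cauchy_meets[OF points_cauchy[OF F(1)] D(3) D(3)] by blast
    then have "eventually (\<lambda>x. x \<in> A) (\<iota> x)"
      unfolding eventually_\<iota>[OF x(2)]
      using star_subset_set_star[OF x(1), of \<beta>] D(2,4) by (intro bexI[of _ \<beta>]) auto
    then have "\<iota> x \<in> W" using A(2) \<iota>_in_points[OF x(2)] by (auto simp: completion_extent_def)
    then show ?thesis using x(2) by blast
  qed
  then show "points \<subseteq> Abstract_Topology.closure_of hat (\<iota> ` X)"
    unfolding closure_of_def topspace_hat by blast
qed

section \<open>Continuous extension\<close>

text \<open>The condition asks for \<open>set_star D \<alpha>\<close> rather than for \<open>D\<close> itself in the filters nearby. The weaker form
costs nothing, since members of a round filter contain thickenings of thickenings, and it is what a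
group action satisfies: moving the group element moves \<open>D\<close> slightly.\<close>

lemma continuous_map_round:
  assumes cau: "\<And>t. t \<in> topspace T \<Longrightarrow> cauchy (\<Phi> t)"
    and stable: "\<And>t D \<alpha>. \<lbrakk>t \<in> topspace T; D \<subseteq> X; eventually (\<lambda>x. x \<in> D) (\<Phi> t); \<alpha> \<in> \<U>\<rbrakk> \<Longrightarrow>
      \<exists>N. openin T N \<and> t \<in> N \<and> (\<forall>s\<in>N. eventually (\<lambda>x. x \<in> set_star D \<alpha>) (\<Phi> s))"
  shows "continuous_map T hat (\<lambda>t. round_filter \<U> (\<Phi> t))"
  unfolding continuous_map_def topspace_hat
proof (intro conjI allI impI)
  show "(\<lambda>t. round_filter \<U> (\<Phi> t)) \<in> topspace T \<rightarrow> points"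
    using cau round_in_points by blast
  fix W assume W: "openin hat W"
  have "\<exists>N. openin T N \<and> t \<in> N \<and> N \<subseteq> {x \<in> topspace T. round_filter \<U> (\<Phi> x) \<in> W}"
    if t: "t \<in> topspace T" "round_filter \<U> (\<Phi> t) \<in> W" for t
  proof -
    obtain A where A: "eventually (\<lambda>x. x \<in> A) (round_filter \<U> (\<Phi> t))" "extent A \<subseteq> W"
      using W t(2) unfolding openin_hat by blast
    obtain D \<alpha> where D: "D \<subseteq> X" "\<alpha> \<in> \<U>" "eventually (\<lambda>x. x \<in> D) (\<Phi> t)" "set_star D \<alpha> \<subseteq> A"
      using round_star[OF cau[OF t(1)] A(1)] by blast
    obtain \<beta> where \<beta>: "\<beta> \<in> \<U>" "\<And>B. \<lbrakk>B \<in> \<beta>; B \<noteq> {}\<rbrakk> \<Longrightarrow> \<exists>A\<in>\<alpha>. set_star B \<beta> \<subseteq> A"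
      using star_refinement[OF D(2)] by blast
    have star2: "set_star (set_star D \<beta>) \<beta> \<subseteq> set_star D \<alpha>"
    proof
      fix z assume "z \<in> set_star (set_star D \<beta>) \<beta>"
      then obtain B C where B: "B \<in> \<beta>" "z \<in> B" "C \<in> \<beta>" "B \<inter> C \<noteq> {}" "C \<inter> D \<noteq> {}"
        by (auto simp: set_star_def)
      then obtain E where E: "E \<in> \<alpha>" "set_star C \<beta> \<subseteq> E" using \<beta>(2)[of C] by blast
      have "B \<subseteq> set_star C \<beta>" "C \<subseteq> set_star C \<beta>" using B unfolding set_star_def by blast+
      then have "z \<in> E" "E \<inter> D \<noteq> {}" using B E(2) by blast+
      then show "z \<in> set_star D \<alpha>" using E(1) unfolding set_star_def by blast
    qed
    obtain N where N: "openin T N" "t \<in> N" "\<And>s. s \<in> N \<Longrightarrow> eventually (\<lambda>x. x \<in> set_star D \<beta>) (\<Phi> s)"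
      using stable[OF t(1) D(1,3) \<beta>(1)] by blast
    have "round_filter \<U> (\<Phi> s) \<in> W" if s: "s \<in> N" for s
    proof -
      have c: "cauchy (\<Phi> s)" using cau N(1) s openin_subset by blast
      have "eventually (\<lambda>x. x \<in> A) (round_filter \<U> (\<Phi> s))"
        using star2 D(4) by (intro round_intro[OF c N(3)[OF s] \<beta>(1)]) blast
      then show ?thesis using A(2) round_in_points[OF c] by (auto simp: completion_extent_def)
    qed
    then show ?thesis using N(1,2) openin_subset[OF N(1)] by blast
  qed
  then show "openin T {x \<in> topspace T. round_filter \<U> (\<Phi> x) \<in> W}"
    unfolding openin_subopen[of T "{x \<in> topspace T. round_filter \<U> (\<Phi> x) \<in> W}"] by simp
qed

end

section \<open>The median uniformity\<close>

lemma subbase_in_generated_uniformity: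
  assumes "\<S> \<subseteq> covers X" "\<sigma> \<in> \<S>"
  shows "\<sigma> \<in> generated_uniformity X \<S>"
proof -
  have "cover_refines (cover_meet X {\<sigma>}) \<sigma>"
    unfolding cover_refines_def cover_meet_def by auto
  then show ?thesis
    unfolding generated_uniformity_def using assms
    by (intro CollectI conjI exI[of _ "{\<sigma>}"]) auto
qed

text \<open>To refine a uniform cover it suffices to treat finitely many subbasic covers simultaneously.
The sets \<open>K q i\<close> stand for stars of points, for members of a filter, or for pieces of orbits;
\<open>q\<close> is the object to be found, constrained by \<open>P\<close>.\<close>

lemma generated_uniformity_choose:
  assumes \<alpha>: "\<alpha> \<in> generated_uniformity X \<S>"
    and Q: "\<And>\<C>. \<lbrakk>finite \<C>; \<C> \<subseteq> \<S>\<rbrakk> \<Longrightarrow> \<exists>q. P q \<and> (\<forall>\<sigma>\<in>\<C>. \<forall>i\<in>I. \<exists>A\<in>\<sigma>. K q i \<subseteq> A)"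
    and X: "\<And>q i. \<lbrakk>P q; i \<in> I\<rbrakk> \<Longrightarrow> K q i \<subseteq> X"
  shows "\<exists>q. P q \<and> (\<forall>i\<in>I. \<exists>A\<in>\<alpha>. K q i \<subseteq> A)"
proof -
  obtain \<C> where \<C>: "finite \<C>" "\<C> \<subseteq> \<S>" "cover_refines (cover_meet X \<C>) \<alpha>"
    using \<alpha> by (auto simp: generated_uniformity_def)
  obtain q where q: "P q" "\<forall>\<sigma>\<in>\<C>. \<forall>i\<in>I. \<exists>A\<in>\<sigma>. K q i \<subseteq> A"
    using Q[OF \<C>(1,2)] by (elim exE conjE)
  have "\<exists>A\<in>\<alpha>. K q i \<subseteq> A" if i: "i \<in> I" for i
  proof -
    have "\<forall>\<sigma>\<in>\<C>. \<exists>A. A \<in> \<sigma> \<and> K q i \<subseteq> A"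
      using q(2) i unfolding Bex_def by blast
    from bchoice[OF this] obtain f where f: "\<forall>\<sigma>\<in>\<C>. f \<sigma> \<in> \<sigma> \<and> K q i \<subseteq> f \<sigma>" ..
    then have "X \<inter> (\<Inter>\<sigma>\<in>\<C>. f \<sigma>) \<in> cover_meet X \<C>"
      unfolding cover_meet_def by (intro CollectI exI[of _ f] conjI refl) simp
    then obtain A where A: "A \<in> \<alpha>" "X \<inter> (\<Inter>\<sigma>\<in>\<C>. f \<sigma>) \<subseteq> A"
      using \<C>(3) unfolding cover_refines_def by (elim ballE bexE) auto
    have "K q i \<subseteq> X" using X[OF q(1) i] .
    moreover have "K q i \<subseteq> f \<sigma>" if "\<sigma> \<in> \<C>" for \<sigma> using f that by simp
    ultimately have "K q i \<subseteq> X \<inter> (\<Inter>\<sigma>\<in>\<C>. f \<sigma>)" by (simp add: INT_greatest)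
    then show ?thesis using A by (intro bexI[of _ A]) auto
  qed
  then show ?thesis by (intro exI[of _ q] conjI q(1) ballI)
qed

lemma generated_covering_uniformity:
  assumes \<S>: "\<S> \<subseteq> covers X"
    and bary: "\<And>\<sigma>. \<sigma> \<in> \<S> \<Longrightarrow> \<exists>\<beta>\<in>generated_uniformity X \<S>. \<forall>x\<in>X. \<exists>A\<in>\<sigma>. star x \<beta> \<subseteq> A"
  shows "covering_uniformity X (generated_uniformity X \<S>)"
proof
  let ?U = "generated_uniformity X \<S>"
  show "?U \<subseteq> covers X" by (rule generated_uniformity_subset_covers)
  show "?U \<noteq> {}" using trivial_cover_in_generated_uniformity by blast
  show ref: "\<exists>\<gamma>\<in>?U. cover_refines \<gamma> \<alpha> \<and> cover_refines \<gamma> \<beta>" if "\<alpha> \<in> ?U" "\<beta> \<in> ?U" for \<alpha> \<beta>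
    using generated_uniformity_refine[OF \<S> that] .
  fix \<alpha> assume \<alpha>: "\<alpha> \<in> ?U"
  have "\<exists>\<beta>. \<beta> \<in> ?U \<and> (\<forall>x\<in>X. \<exists>A\<in>\<alpha>. star x \<beta> \<subseteq> A)"
  proof (rule generated_uniformity_choose[OF \<alpha>])
    fix \<C> assume "finite \<C>" "\<C> \<subseteq> \<S>"
    then show "\<exists>\<beta>. \<beta> \<in> ?U \<and> (\<forall>\<sigma>\<in>\<C>. \<forall>x\<in>X. \<exists>A\<in>\<sigma>. star x \<beta> \<subseteq> A)"
    proof (induction \<C> rule: finite_induct)
      case empty
      then show ?case using trivial_cover_in_generated_uniformity by blast
    next
      case (insert \<sigma> \<C>)
      then obtain \<beta> where \<beta>: "\<beta> \<in> ?U" "\<And>\<sigma> x. \<lbrakk>\<sigma> \<in> \<C>; x \<in> X\<rbrakk> \<Longrightarrow> \<exists>A\<in>\<sigma>. star x \<beta> \<subseteq> A" by blast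
      obtain \<delta> where \<delta>: "\<delta> \<in> ?U" "\<And>x. x \<in> X \<Longrightarrow> \<exists>A\<in>\<sigma>. star x \<delta> \<subseteq> A"
        using bary[of \<sigma>] insert.prems by blast
      obtain \<gamma> where \<gamma>: "\<gamma> \<in> ?U" "cover_refines \<gamma> \<beta>" "cover_refines \<gamma> \<delta>"
        using ref[OF \<beta>(1) \<delta>(1)] by blast
      have "\<exists>A\<in>\<rho>. star x \<gamma> \<subseteq> A" if "\<rho> \<in> insert \<sigma> \<C>" "x \<in> X" for \<rho> x
        using that \<beta>(2)[of \<rho> x] \<delta>(2)[of x] star_mono_refines[OF \<gamma>(2), of x]
          star_mono_refines[OF \<gamma>(3), of x] by (metis insertE subset_trans)
      then show ?case using \<gamma>(1) by blast
    qed
  next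
    fix \<beta> x assume "\<beta> \<in> ?U"
    then show "star x \<beta> \<subseteq> X"
      using generated_uniformity_subset_covers[of X \<S>] by (auto simp: star_def covers_def)
  qed
  then show "\<exists>\<beta>\<in>?U. \<forall>x\<in>X. \<exists>A\<in>\<alpha>. star x \<beta> \<subseteq> A" by blast
qed

lemma cauchy_generated:
  assumes F: "F \<noteq> bot" "eventually (\<lambda>x. x \<in> X) F"
    and \<S>: "\<And>\<sigma>. \<sigma> \<in> \<S> \<Longrightarrow> \<exists>A\<in>\<sigma>. eventually (\<lambda>x. x \<in> A) F"
  shows "cauchy_filter_on X (generated_uniformity X \<S>) F"
  unfolding cauchy_filter_on_def
proof (intro conjI ballI)
  show "F \<noteq> bot" by (rule F(1))
  show "F \<le> principal X" using F(2) by (simp add: le_principal)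
  fix \<alpha> assume \<alpha>: "\<alpha> \<in> generated_uniformity X \<S>"
  have "\<exists>K. (eventually (\<lambda>x. x \<in> K) F \<and> K \<subseteq> X) \<and> (\<forall>i\<in>{()}. \<exists>A\<in>\<alpha>. K \<subseteq> A)"
  proof (rule generated_uniformity_choose[OF \<alpha>])
    fix \<C> assume \<C>: "finite \<C>" "\<C> \<subseteq> \<S>"
    have "\<forall>\<sigma>\<in>\<C>. \<exists>A. A \<in> \<sigma> \<and> eventually (\<lambda>x. x \<in> A) F"
      using \<S> \<C>(2) by (meson subsetD)
    then obtain f where f: "\<And>\<sigma>. \<sigma> \<in> \<C> \<Longrightarrow> f \<sigma> \<in> \<sigma> \<and> eventually (\<lambda>x. x \<in> f \<sigma>) F"
      using bchoice[of \<C> "\<lambda>\<sigma> A. A \<in> \<sigma> \<and> eventually (\<lambda>x. x \<in> A) F"] by auto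
    then have "eventually (\<lambda>x. \<forall>\<sigma>\<in>\<C>. x \<in> f \<sigma>) F"
      using \<C>(1) by (intro eventually_ball_finite) auto
    then have "eventually (\<lambda>x. x \<in> X \<inter> (\<Inter>\<sigma>\<in>\<C>. f \<sigma>)) F"
      using F(2) by eventually_elim auto
    moreover have "\<exists>A\<in>\<sigma>. X \<inter> (\<Inter>\<sigma>\<in>\<C>. f \<sigma>) \<subseteq> A" if "\<sigma> \<in> \<C>" for \<sigma>
      using f[OF that] that by (intro bexI[of _ "f \<sigma>"]) auto
    ultimately show "\<exists>K. (eventually (\<lambda>x. x \<in> K) F \<and> K \<subseteq> X) \<and>
        (\<forall>\<sigma>\<in>\<C>. \<forall>i\<in>{()}. \<exists>A\<in>\<sigma>. K \<subseteq> A)"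
      by (intro exI[of _ "X \<inter> (\<Inter>\<sigma>\<in>\<C>. f \<sigma>)"]) simp
  qed simp
  then obtain K A where "eventually (\<lambda>x. x \<in> K) F" "A \<in> \<alpha>" "K \<subseteq> A" by auto
  then show "\<exists>A\<in>\<alpha>. eventually (\<lambda>x. x \<in> A) F"
    using eventually_mem_mono[of K F A] by auto
qed

context median_algebra
begin

abbreviation "subbase \<equiv> {{branch X m u v, branch X m v u} | u v. chain_interval X m u v \<and> u \<noteq> v}"

lemma branch_cover_uniform:
  assumes "chain_interval X m u v" "u \<noteq> v"
  shows "{branch X m u v, branch X m v u} \<in> median_uniformity X m"
  unfolding median_uniformity_def
proof (rule subbase_in_generated_uniformity[OF median_subbase_covers[OF median_algebra_axioms]])
  show "{branch X m u v, branch X m v u} \<in> subbase"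
    by (rule CollectI, rule exI[of _ u], rule exI[of _ v], intro conjI refl assms)
qed

text \<open>For \<open>w\<close> strictly inside $[u,v]$, let \<open>\<gamma>\<close> refine the covers given by $[u,w]$ and $[w,v]$. If
$x \in B^u_w$ then $x \notin B^v_w$, so each member of \<open>\<gamma>\<close> around \<open>x\<close> lies in $B^w_v \subseteq B^u_v$;
otherwise each lies in $B^w_u \subseteq B^v_u$.\<close>

lemma branch_cover_barycentric:
  assumes uv: "chain_interval X m u v" "u \<noteq> v"
  shows "\<exists>\<beta>\<in>median_uniformity X m. \<forall>x\<in>X.
    \<exists>A\<in>{branch X m u v, branch X m v u}. star x \<beta> \<subseteq> A"
proof (cases "\<exists>w\<in>X. lies_between m u w v \<and> w \<noteq> u \<and> w \<noteq> v")
  case False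
  let ?\<beta> = "{branch X m u v, branch X m v u}"
  have "branch X m u v \<inter> branch X m v u = {}"
    using branch_disjoint_two_points[OF uv(1)] False by blast
  then have "star x ?\<beta> \<subseteq> branch X m u v \<or> star x ?\<beta> \<subseteq> branch X m v u" for x
    unfolding star_def by blast
  then have "\<forall>x\<in>X. \<exists>A\<in>?\<beta>. star x ?\<beta> \<subseteq> A" by simp
  then show ?thesis by (rule bexI[OF _ branch_cover_uniform[OF uv]])
next
  case True
  then obtain w where w: "w \<in> X" "lies_between m u w v" "w \<noteq> u" "w \<noteq> v" by blast
  note X = chain_intervalD[OF uv(1)]
  have w': "lies_between m v w u" using w X between_commute by simp
  obtain \<gamma> where \<gamma>: "\<gamma> \<in> median_uniformity X m"
      "cover_refines \<gamma> {branch X m u w, branch X m w u}"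
      "cover_refines \<gamma> {branch X m w v, branch X m v w}"
    using median_uniformity_refine[OF median_algebra_axioms
        branch_cover_uniform[OF chain_subinterval(1)[OF uv(1) w(1,2)] w(3)[symmetric]]
        branch_cover_uniform[OF chain_subinterval(2)[OF uv(1) w(1,2)] w(4)]] by blast
  have disj: "branch X m u w \<inter> branch X m v w = {}"
    using branch_disjoint[OF uv(1) w(1,2)] .
  have sub: "branch X m w v \<subseteq> branch X m u v" "branch X m w u \<subseteq> branch X m v u"
    using branch_mono X w w' by blast+
  have "star x \<gamma> \<subseteq> branch X m u v \<or> star x \<gamma> \<subseteq> branch X m v u" for x
  proof (cases "x \<in> branch X m u w")
    case True
    have "C \<subseteq> branch X m u v" if C: "C \<in> \<gamma>" "x \<in> C" for C
    proof -
      have "C \<subseteq> branch X m w v \<or> C \<subseteq> branch X m v w"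
        using \<gamma>(3) C(1) by (auto simp: cover_refines_def)
      then show ?thesis using True C(2) disj sub by blast
    qed
    then show ?thesis unfolding star_def by blast
  next
    case False
    have "C \<subseteq> branch X m v u" if C: "C \<in> \<gamma>" "x \<in> C" for C
    proof -
      have "C \<subseteq> branch X m u w \<or> C \<subseteq> branch X m w u"
        using \<gamma>(2) C(1) by (auto simp: cover_refines_def)
      then show ?thesis using False C(2) sub by blast
    qed
    then show ?thesis unfolding star_def by blast
  qed
  then have "\<forall>x\<in>X. \<exists>A\<in>{branch X m u v, branch X m v u}. star x \<gamma> \<subseteq> A" by simp
  then show ?thesis by (rule bexI[OF _ \<gamma>(1)])
qed

lemma covering_uniformity_median: "covering_uniformity X (median_uniformity X m)"
  unfolding median_uniformity_def
proof (rule generated_covering_uniformity[OF median_subbase_covers[OF median_algebra_axioms]])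
  fix \<sigma> assume "\<sigma> \<in> subbase"
  then obtain u v where uv: "\<sigma> = {branch X m u v, branch X m v u}" "chain_interval X m u v" "u \<noteq> v"
    unfolding mem_Collect_eq by (elim exE conjE)
  show "\<exists>\<beta>\<in>generated_uniformity X subbase. \<forall>x\<in>X. \<exists>A\<in>\<sigma>. star x \<beta> \<subseteq> A"
    unfolding uv(1) by (rule branch_cover_barycentric[OF uv(2,3), unfolded median_uniformity_def])
qed

sublocale covering_uniformity X "median_uniformity X m"
  by (rule covering_uniformity_median)

lemma cauchy_medianI:
  assumes "F \<noteq> bot" "eventually (\<lambda>x. x \<in> X) F"
    and "\<And>u v. \<lbrakk>chain_interval X m u v; u \<noteq> v\<rbrakk> \<Longrightarrow>
      eventually (\<lambda>x. x \<in> branch X m u v) F \<or> eventually (\<lambda>x. x \<in> branch X m v u) F"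
  shows "cauchy F"
  unfolding median_uniformity_def
proof (rule cauchy_generated[OF assms(1,2)])
  fix \<sigma> assume "\<sigma> \<in> subbase"
  then obtain u v where uv: "\<sigma> = {branch X m u v, branch X m v u}" "chain_interval X m u v" "u \<noteq> v"
    unfolding mem_Collect_eq by (elim exE conjE)
  show "\<exists>A\<in>\<sigma>. eventually (\<lambda>x. x \<in> A) F" unfolding uv(1) using assms(3)[OF uv(2,3)] by simp
qed

lemma cauchy_branch:
  assumes "cauchy F" "chain_interval X m u v" "u \<noteq> v"
  shows "eventually (\<lambda>x. x \<in> branch X m u v) F \<or> eventually (\<lambda>x. x \<in> branch X m v u) F"
  using cauchy_cover[OF assms(1) branch_cover_uniform[OF assms(2,3)]] by simp

text \<open>The projection \<open>w\<close> of \<open>x\<close> to $[u,v]$ differs from \<open>v\<close>, and the cover given by $[w,v]$ has only one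
member containing \<open>x\<close>.\<close>

lemma openin_branch:
  assumes uv: "chain_interval X m u v"
  shows "openin (median_topology X m) (branch X m u v)"
  unfolding median_topology_def openin_\<tau>
proof (intro conjI ballI branch_subset)
  fix x assume x: "x \<in> branch X m u v"
  note X = chain_intervalD[OF uv]
  define w where "w = m u x v"
  have xX: "x \<in> X" "w \<noteq> v" using x by (auto simp: branch_def w_def)
  have w: "w \<in> X" "lies_between m u w v" "lies_between m v w x"
    using median_between[of u x v] xX X closed between_commute by (auto simp: w_def)
  have "x \<notin> branch X m v w" using w X by (simp add: branch_iff)
  then have "star x {branch X m w v, branch X m v w} \<subseteq> branch X m w v"
    by (auto simp: star_def)
  also have "\<dots> \<subseteq> branch X m u v" using branch_mono w X by blast
  finally show "\<exists>\<alpha>\<in>median_uniformity X m. star x \<alpha> \<subseteq> branch X m u v"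
    using branch_cover_uniform[OF chain_subinterval(2)[OF uv w(1,2)] xX(2)] by blast
qed

text \<open>Take for \<open>a\<close> a point \<open>t\<close> strictly between \<open>w\<close> and \<open>v\<close> if there is one, with \<open>N\<close> the branch of \<open>w\<close>
at \<open>t\<close>. Otherwise the cover given by $[w,v]$ is a partition, and \<open>a = w\<close> works.\<close>

lemma separating_branch:
  assumes wv: "chain_interval X m w v" "w \<noteq> v"
  shows "\<exists>a\<in>X. a \<noteq> v \<and> lies_between m w a v \<and>
    (\<exists>N. openin (median_topology X m) N \<and> w \<in> N \<and> N \<inter> branch X m v a = {})"
proof (cases "\<exists>t\<in>X. lies_between m w t v \<and> t \<noteq> w \<and> t \<noteq> v")
  case True
  then obtain t where t: "t \<in> X" "lies_between m w t v" "t \<noteq> w" "t \<noteq> v" by blast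
  have "openin (median_topology X m) (branch X m w t)"
    using openin_branch chain_subinterval(1)[OF wv(1) t(1,2)] by blast
  then show ?thesis
    using t branch_disjoint[OF wv(1) t(1,2)] branch_endpoint(1)[of w t] chain_intervalD[OF wv(1)]
    by metis
next
  case False
  then have "branch X m w v \<inter> branch X m v w = {}"
    using branch_disjoint_two_points[OF wv(1)] by blast
  then show ?thesis
    using openin_branch[OF wv(1)] branch_endpoint(1)[of w v] chain_intervalD[OF wv(1)]
      between_refl(1)[of w v] wv(2) by metis
qed

end

section \<open>Boundedness of the action\<close>

locale median_action = median_algebra X m for X :: "'a set" and m +
  fixes G :: "('g, 'r) monoid_scheme" (structure) and TG :: "'g topology" and \<phi> :: "'g \<Rightarrow> 'a \<Rightarrow> 'a"
  assumes topological_group: "topological_group G TG"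
    and separately_continuous: "separately_continuous_action G TG (median_topology X m) \<phi>"
    and automorphisms: "acts_by_median_automorphisms G X m \<phi>"
begin

lemma group_action: "group_action G X \<phi>"
  using automorphisms by (simp add: acts_by_median_automorphisms_def)

lemma group: "group G"
  using topological_group by (simp add: topological_group_def)

lemma topspace_TG: "topspace TG = carrier G"
  using topological_group by (simp add: topological_group_def)

lemma action_closed: "\<lbrakk>g \<in> carrier G; x \<in> X\<rbrakk> \<Longrightarrow> \<phi> g x \<in> X"
  using group_action.element_image[OF group_action] by blast

lemma action_one: "x \<in> X \<Longrightarrow> \<phi> \<one> x = x"
  using group_action.id_eq_one[OF group_action] by (metis restrict_apply')

lemma action_mult: "\<lbrakk>g \<in> carrier G; h \<in> carrier G; x \<in> X\<rbrakk> \<Longrightarrow> \<phi> (g \<otimes> h) x = \<phi> g (\<phi> h x)"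
  using group_action.composition_rule[OF group_action] by blast

lemma action_inv:
  assumes "g \<in> carrier G" "x \<in> X"
  shows "\<phi> (inv g) (\<phi> g x) = x" "\<phi> g (\<phi> (inv g) x) = x"
  using assms action_mult[of "inv g" g x] action_mult[of g "inv g" x] action_one
  by (simp_all add: group.l_inv group.r_inv group.inv_closed group)

lemma action_median:
  "\<lbrakk>g \<in> carrier G; x \<in> X; y \<in> X; z \<in> X\<rbrakk> \<Longrightarrow> \<phi> g (m x y z) = m (\<phi> g x) (\<phi> g y) (\<phi> g z)"
  using automorphisms by (simp add: acts_by_median_automorphisms_def median_preserving_def)

lemma orbit_openin:
  assumes "x \<in> X" "openin (median_topology X m) N"
  shows "openin TG {g \<in> carrier G. \<phi> g x \<in> N}"
  using separately_continuous assms
  unfolding separately_continuous_action_def continuous_map_def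
  by (auto simp: topspace_TG topspace_median_topology[OF median_algebra_axioms])

lemma action_between:
  assumes g: "g \<in> carrier G" and X: "x \<in> X" "a \<in> X" "b \<in> X"
  shows "lies_between m (\<phi> g x) (\<phi> g a) (\<phi> g b) \<longleftrightarrow> lies_between m x a b"
  unfolding lies_between_def
  using action_median[OF g X] action_inv(1)[OF g, of "m x a b"] action_inv(1)[OF g, of a] X closed
  by metis

text \<open>The neighbourhood \<open>V\<close> is determined by the orbits of \<open>w\<close> and \<open>v\<close> only, yet it controls \<open>gx\<close> for all
\<open>x\<close> on the far side of \<open>w\<close>: \<open>gw\<close> is between \<open>gv\<close> and \<open>gx\<close>, and it is kept outside the convex set
$B^v_a$, which contains \<open>gv\<close> and would contain \<open>gx\<close> if \<open>gx\<close> left $B^u_v$.\<close>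

lemma one_sided_bound:
  assumes uv: "chain_interval X m u v" and w: "w \<in> X" "lies_between m u w v" "w \<noteq> v"
  shows "\<exists>V. openin TG V \<and> \<one> \<in> V \<and>
    (\<forall>g\<in>V. \<forall>x\<in>X. lies_between m v w x \<longrightarrow> \<phi> g x \<in> branch X m u v)"
proof -
  note X = chain_intervalD[OF uv]
  obtain a N where a: "a \<in> X" "a \<noteq> v" "lies_between m w a v"
    and N: "openin (median_topology X m) N" "w \<in> N" "N \<inter> branch X m v a = {}"
    using separating_branch[OF chain_subinterval(2)[OF uv w(1,2)] w(3)] by blast
  have vwu: "lies_between m v w u" and vaw: "lies_between m v a w"
    using w a X between_commute by simp_all
  have uav: "lies_between m u a v"
    using between_trans(1)[OF _ _ _ _ vaw vwu] a w X between_commute by simp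
  have chain: "chain_interval X m v a"
    using chain_interval_commute chain_subinterval(2)[OF uv a(1) uav] by blast
  define V where "V = {g \<in> carrier G. \<phi> g w \<in> N} \<inter> {g \<in> carrier G. \<phi> g v \<in> branch X m v a}"
  have "openin TG V"
    unfolding V_def using orbit_openin[OF w(1) N(1)] orbit_openin[OF X(2) openin_branch[OF chain]] by blast
  moreover have "\<one> \<in> V"
    unfolding V_def using N(2) branch_endpoint(1)[of v a] X a(1,2) w(1)
    by (simp add: action_one group.is_monoid monoid.one_closed group)
  moreover have "\<phi> g x \<in> branch X m u v" if g: "g \<in> V" and x: "x \<in> X" "lies_between m v w x" for g x
  proof (rule ccontr)
    assume notin: "\<phi> g x \<notin> branch X m u v"
    have gG: "g \<in> carrier G" "\<phi> g w \<in> N" "\<phi> g v \<in> branch X m v a" using g by (auto simp: V_def)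
    define y where "y = \<phi> g x"
    have y: "y \<in> X" using action_closed gG(1) x(1) by (simp add: y_def)
    have uvy: "lies_between m u v y" using notin y X by (simp add: branch_iff y_def)
    have "lies_between m a v y"
      using between_trans(2)[OF _ _ _ _ uav uvy] a X y by simp
    then have "\<not> lies_between m v a y"
      using between_antisym[of y a v] a(1,2) X y between_commute by blast
    then have "y \<in> branch X m v a" using y X a by (simp add: branch_iff)
    moreover have "lies_between m (\<phi> g v) (\<phi> g w) y"
      using action_between[OF gG(1)] x w(1) X by (simp add: y_def)
    ultimately have "\<phi> g w \<in> branch X m v a"
      using branch_majority[OF chain gG(3)] action_closed[OF gG(1) w(1)] by blast
    then show False using gG(2) N(3) by blast
  qed
  ultimately show ?thesis by (intro exI[of _ V] conjI ballI impI)
qed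

text \<open>If some \<open>w\<close> lies strictly inside $[u,v]$, every \<open>x\<close> has \<open>w\<close> between itself and \<open>v\<close> or between itself
and \<open>u\<close>, and the one-sided bound applies with \<open>w = w'\<close>. Otherwise every \<open>x\<close> projects to \<open>u\<close> or to \<open>v\<close>,
and the endpoints themselves serve as \<open>w\<close> and \<open>w'\<close>.\<close>

lemma branch_cover_bound:
  assumes uv: "chain_interval X m u v" "u \<noteq> v"
  shows "\<exists>V. openin TG V \<and> \<one> \<in> V \<and>
    (\<forall>x\<in>X. \<exists>A\<in>{branch X m u v, branch X m v u}. (\<lambda>g. \<phi> g x) ` V \<subseteq> A)"
proof -
  note X = chain_intervalD[OF uv(1)]
  have "\<exists>w\<in>X. \<exists>w'\<in>X. lies_between m u w v \<and> w \<noteq> v \<and> lies_between m v w' u \<and> w' \<noteq> u \<and>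
      (\<forall>x\<in>X. lies_between m v w x \<or> lies_between m u w' x)"
  proof (cases "\<exists>w\<in>X. lies_between m u w v \<and> w \<noteq> u \<and> w \<noteq> v")
    case True
    then obtain w where w: "w \<in> X" "lies_between m u w v" "w \<noteq> u" "w \<noteq> v" by blast
    have "lies_between m v w x \<or> lies_between m u w x" if "x \<in> X" for x
      using branch_disjoint[OF uv(1) w(1,2)] that branch_iff X w(1) by blast
    moreover have "lies_between m v w u" using w X between_commute by simp
    ultimately show ?thesis using w by blast
  next
    case False
    then have "branch X m u v \<inter> branch X m v u = {}"
      using branch_disjoint_two_points[OF uv(1)] by blast
    then have "lies_between m v u x \<or> lies_between m u v x" if "x \<in> X" for x
      using that branch_iff X by blast
    then show ?thesis
      using X uv(2) between_refl(1) by blast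
  qed
  then obtain w w' where w: "w \<in> X" "lies_between m u w v" "w \<noteq> v"
    and w': "w' \<in> X" "lies_between m v w' u" "w' \<noteq> u"
    and ww': "\<And>x. x \<in> X \<Longrightarrow> lies_between m v w x \<or> lies_between m u w' x" by blast
  obtain V where V: "openin TG V" "\<one> \<in> V"
    "\<And>g x. \<lbrakk>g \<in> V; x \<in> X; lies_between m v w x\<rbrakk> \<Longrightarrow> \<phi> g x \<in> branch X m u v"
    using one_sided_bound[OF uv(1) w] by blast
  obtain V' where V': "openin TG V'" "\<one> \<in> V'"
    "\<And>g x. \<lbrakk>g \<in> V'; x \<in> X; lies_between m u w' x\<rbrakk> \<Longrightarrow> \<phi> g x \<in> branch X m v u"
    using one_sided_bound[OF chain_interval_commute[OF uv(1)] w'] by blast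
  have bound: "\<exists>A\<in>{branch X m u v, branch X m v u}. (\<lambda>g. \<phi> g x) ` (V \<inter> V') \<subseteq> A" if x: "x \<in> X" for x
  proof -
    have "(\<lambda>g. \<phi> g x) ` (V \<inter> V') \<subseteq> branch X m u v" if "lies_between m v w x"
      using V(3)[OF _ x that] by (intro image_subsetI) simp
    moreover have "(\<lambda>g. \<phi> g x) ` (V \<inter> V') \<subseteq> branch X m v u" if "lies_between m u w' x"
      using V'(3)[OF _ x that] by (intro image_subsetI) simp
    ultimately show ?thesis using ww'[OF x] by (elim disjE) simp_all
  qed
  show ?thesis
  proof (intro exI conjI ballI)
    show "openin TG (V \<inter> V')" "\<one> \<in> V \<inter> V'"
      using V(1,2) V'(1,2) by (simp_all add: openin_Int)
  qed (rule bound)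
qed

lemma bounded_neighbourhood:
  assumes \<alpha>: "\<alpha> \<in> median_uniformity X m"
  shows "\<exists>V. (openin TG V \<and> \<one> \<in> V) \<and> (\<forall>x\<in>X. \<exists>A\<in>\<alpha>. (\<lambda>g. \<phi> g x) ` V \<subseteq> A)"
proof -
  define bound where "bound V \<sigma> \<longleftrightarrow> (\<forall>x\<in>X. \<exists>A\<in>\<sigma>. (\<lambda>g. \<phi> g x) ` V \<subseteq> A)" for V \<sigma>
  have bound_mono: "bound W \<sigma>" if V: "bound V \<sigma>" "W \<subseteq> V" for V W \<sigma>
    unfolding bound_def
  proof
    fix x assume "x \<in> X"
    then obtain A where "A \<in> \<sigma>" "(\<lambda>g. \<phi> g x) ` V \<subseteq> A" using V(1) unfolding bound_def by blast
    moreover have "(\<lambda>g. \<phi> g x) ` W \<subseteq> (\<lambda>g. \<phi> g x) ` V" using V(2) by (rule image_mono)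
    ultimately show "\<exists>A\<in>\<sigma>. (\<lambda>g. \<phi> g x) ` W \<subseteq> A" by (meson subset_trans)
  qed
  have single: "\<exists>W. openin TG W \<and> \<one> \<in> W \<and> bound W \<sigma>" if \<sigma>: "\<sigma> \<in> subbase" for \<sigma>
  proof -
    obtain u v where uv: "\<sigma> = {branch X m u v, branch X m v u}" "chain_interval X m u v" "u \<noteq> v"
      using \<sigma> unfolding mem_Collect_eq by (elim exE conjE)
    show ?thesis unfolding uv(1) bound_def by (rule branch_cover_bound[OF uv(2,3)])
  qed
  have finite_case: "\<exists>V. (openin TG V \<and> \<one> \<in> V) \<and> (\<forall>\<sigma>\<in>\<C>. bound V \<sigma>)"
    if "finite \<C>" "\<And>\<sigma>. \<sigma> \<in> \<C> \<Longrightarrow> \<exists>W. openin TG W \<and> \<one> \<in> W \<and> bound W \<sigma>" for \<C>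
    using that
  proof (induction \<C> rule: finite_induct)
    case empty
    have "\<one> \<in> topspace TG" by (simp add: topspace_TG group.is_monoid monoid.one_closed group)
    then show ?case by blast
  next
    case (insert \<sigma> \<C>)
    then obtain V where V: "openin TG V" "\<one> \<in> V" "\<forall>\<sigma>\<in>\<C>. bound V \<sigma>" by auto
    obtain W where W: "openin TG W" "\<one> \<in> W" "bound W \<sigma>" using insert.prems[of \<sigma>] by auto
    have "\<forall>\<rho>\<in>insert \<sigma> \<C>. bound (V \<inter> W) \<rho>"
      using V(3) W(3) bound_mono[of V _ "V \<inter> W"] bound_mono[of W _ "V \<inter> W"] by simp
    then show ?case
      using V(1,2) W(1,2) by (intro exI[of _ "V \<inter> W"] conjI) (simp_all add: openin_Int)
  qed
  show ?thesis
  proof (rule generated_uniformity_choose[OF \<alpha>[unfolded median_uniformity_def]])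
    fix \<C> assume \<C>: "finite \<C>" "\<C> \<subseteq> subbase"
    show "\<exists>V. (openin TG V \<and> \<one> \<in> V) \<and>
        (\<forall>\<sigma>\<in>\<C>. \<forall>x\<in>X. \<exists>A\<in>\<sigma>. (\<lambda>g. \<phi> g x) ` V \<subseteq> A)"
      using finite_case[OF \<C>(1) single[OF subsetD[OF \<C>(2)]]] unfolding bound_def .
  next
    fix V x assume "openin TG V \<and> \<one> \<in> V" "x \<in> X"
    then show "(\<lambda>g. \<phi> g x) ` V \<subseteq> X"
      using openin_subset[of TG V] action_closed by (auto simp: topspace_TG)
  qed
qed

lemma G_bounded_median_uniformity: "G_bounded G TG X \<phi> (median_uniformity X m)"
  unfolding G_bounded_def
proof
  fix \<alpha> assume "\<alpha> \<in> median_uniformity X m"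
  from bounded_neighbourhood[OF this] obtain V where V: "openin TG V" "\<one> \<in> V"
    "\<forall>x\<in>X. \<exists>A\<in>\<alpha>. (\<lambda>g. \<phi> g x) ` V \<subseteq> A"
    by (elim exE conjE)
  have "V \<subseteq> carrier G" using openin_subset[OF V(1)] by (simp add: topspace_TG)
  then show "\<exists>V. V \<subseteq> carrier G \<and> (\<exists>N. openin TG N \<and> \<one> \<in> N \<and> N \<subseteq> V) \<and>
      cover_refines ((\<lambda>x. (\<lambda>g. \<phi> g x) ` V) ` X) \<alpha>"
    using V by (intro exI[of _ V] conjI) (auto simp: cover_refines_def)
qed

end

section \<open>The action on the completion\<close>

text \<open>Subbasic covers are pulled back along automorphisms with this lemma. It is stated for preimages
since a Cauchy filter is tested against the translates of a chain interval by the inverse element.\<close>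

lemma (in median_algebra) chain_interval_vimage:
  assumes uv: "chain_interval X m (f u) (f v)" "u \<in> X" "v \<in> X"
    and f: "\<And>x. x \<in> X \<Longrightarrow> f x \<in> X"
    and between: "\<And>x a b. \<lbrakk>x \<in> X; a \<in> X; b \<in> X\<rbrakk> \<Longrightarrow>
      lies_between m (f x) (f a) (f b) \<longleftrightarrow> lies_between m x a b"
  shows "chain_interval X m u v"
  unfolding chain_interval_iff
proof (intro conjI ballI impI)
  fix a b assume ab: "a \<in> X" "b \<in> X" "lies_between m u a v \<and> lies_between m u b v"
  then have "lies_between m (f u) (f a) (f v)" "lies_between m (f u) (f b) (f v)"
    using between uv by simp_all
  then have "lies_between m (f u) (f a) (f b) \<or> lies_between m (f u) (f b) (f a)"
    using chain_interval_total[OF uv(1) f[OF ab(1)] f[OF ab(2)]] by blast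
  then show "lies_between m u a b \<or> lies_between m u b a" using between ab uv by simp
qed (rule uv)+

lemma filtermap_eventually_cong:
  assumes "eventually (\<lambda>x. f x = g x) F"
  shows "filtermap f F = filtermap g F"
proof (rule filter_eq_iff[THEN iffD2], rule allI)
  fix P
  show "eventually P (filtermap f F) \<longleftrightarrow> eventually P (filtermap g F)"
    unfolding eventually_filtermap
    by (rule eventually_cong[OF assms]) simp
qed

context median_action
begin

lemma filtermap_action_cauchy:
  assumes g: "g \<in> carrier G" and F: "cauchy F"
  shows "cauchy (filtermap (\<phi> g) F)"
proof (rule cauchy_medianI)
  have FX: "eventually (\<lambda>x. x \<in> X) F" using cauchy_carrier[OF F] .
  show "filtermap (\<phi> g) F \<noteq> bot"
    using F by (simp add: filtermap_bot_iff cauchy_filter_on_def)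
  show "eventually (\<lambda>x. x \<in> X) (filtermap (\<phi> g) F)"
    unfolding eventually_filtermap using FX by eventually_elim (rule action_closed[OF g])
  fix u v assume uv: "chain_interval X m u v" "u \<noteq> v"
  note X = chain_intervalD[OF uv(1)]
  have ginv: "inv g \<in> carrier G" using g group by simp
  define u' where "u' = \<phi> (inv g) u"
  define v' where "v' = \<phi> (inv g) v"
  have u': "u' \<in> X" "\<phi> g u' = u" and v': "v' \<in> X" "\<phi> g v' = v"
    using action_closed[OF ginv] action_inv(2)[OF g] X by (simp_all add: u'_def v'_def)
  have chain: "chain_interval X m u' v'"
    using chain_interval_vimage[of "\<phi> g" u' v'] u' v' uv(1) action_closed[OF g] action_between[OF g]
    by simp
  have map: "eventually (\<lambda>x. \<phi> g x \<in> branch X m a b) F"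
    if a: "a' \<in> X" "\<phi> g a' = a" and b: "b' \<in> X" "\<phi> g b' = b"
      and ev: "eventually (\<lambda>x. x \<in> branch X m a' b') F" for a a' b b'
    using ev
  proof (rule eventually_mono)
    fix x assume x: "x \<in> branch X m a' b'"
    then have "x \<in> X" "\<not> lies_between m a' b' x" using a b branch_iff by simp_all
    then have "\<phi> g x \<in> X" "\<not> lies_between m (\<phi> g a') (\<phi> g b') (\<phi> g x)"
      using action_closed[OF g] action_between[OF g] a(1) b(1) by simp_all
    then show "\<phi> g x \<in> branch X m a b"
      using a b action_closed[OF g a(1)] action_closed[OF g b(1)] branch_iff by simp
  qed
  have "u' \<noteq> v'" using uv(2) u' v' by auto
  then show "eventually (\<lambda>x. x \<in> branch X m u v) (filtermap (\<phi> g) F) \<or>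
      eventually (\<lambda>x. x \<in> branch X m v u) (filtermap (\<phi> g) F)"
    unfolding eventually_filtermap
    using cauchy_branch[OF F chain] map[OF u' v'] map[OF v' u'] by blast
qed

lemma filtermap_action_mult:
  assumes "g \<in> carrier G" "h \<in> carrier G" "eventually (\<lambda>x. x \<in> X) F"
  shows "filtermap (\<phi> g) (filtermap (\<phi> h) F) = filtermap (\<phi> (g \<otimes> h)) F"
  unfolding filtermap_filtermap
  using assms(3) by (intro filtermap_eventually_cong, eventually_elim) (simp add: action_mult assms(1,2))

lemma filtermap_action_one:
  assumes "eventually (\<lambda>x. x \<in> X) F"
  shows "filtermap (\<phi> \<one>) F = F"
proof -
  have "filtermap (\<phi> \<one>) F = filtermap (\<lambda>x. x) F"
    using assms by (intro filtermap_eventually_cong, eventually_elim) (simp add: action_one)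
  then show ?thesis by (simp add: filtermap_ident)
qed

lemma filtermap_action_inv:
  assumes "g \<in> carrier G" "eventually (\<lambda>x. x \<in> X) F"
  shows "filtermap (\<phi> g) (filtermap (\<phi> (inv g)) F) = F"
    "filtermap (\<phi> (inv g)) (filtermap (\<phi> g) F) = F"
  using assms group
  by (simp_all add: filtermap_action_mult filtermap_action_one group.l_inv group.r_inv)

text \<open>Translation by \<open>inv g\<close> is monotone and inverse to translation by \<open>g\<close>, so minimality is preserved.\<close>

lemma filtermap_action_points:
  assumes g: "g \<in> carrier G" and F: "F \<in> points"
  shows "filtermap (\<phi> g) F \<in> points"
  unfolding completion_points_def
proof (intro CollectI conjI allI impI)
  have ginv: "inv g \<in> carrier G" using g group by simp
  note cF = points_cauchy[OF F]
  show "cauchy (filtermap (\<phi> g) F)" by (rule filtermap_action_cauchy[OF g cF])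
  fix F' assume "cauchy F' \<and> filtermap (\<phi> g) F \<le> F'"
  then have F': "cauchy F'" "filtermap (\<phi> g) F \<le> F'" by auto
  have "filtermap (\<phi> (inv g)) (filtermap (\<phi> g) F) \<le> filtermap (\<phi> (inv g)) F'"
    using F'(2) by (rule filtermap_mono)
  then have "F \<le> filtermap (\<phi> (inv g)) F'"
    using filtermap_action_inv(2)[OF g cauchy_carrier[OF cF]] by simp
  then have "filtermap (\<phi> (inv g)) F' = F"
    using F filtermap_action_cauchy[OF ginv F'(1)] unfolding completion_points_def by blast
  then show "F' = filtermap (\<phi> g) F"
    using filtermap_action_inv(1)[OF g cauchy_carrier[OF F'(1)]] by simp
qed

definition extended_action :: "'g \<Rightarrow> 'a filter \<Rightarrow> 'a filter"
  where "extended_action g = (\<lambda>F\<in>points. filtermap (\<phi> g) F)"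

lemma group_action_extended: "group_action G points extended_action"
proof -
  have bij: "extended_action g \<in> Bij points" if g: "g \<in> carrier G" for g
  proof -
    have "inv g \<in> carrier G" using g group by simp
    then have "bij_betw (extended_action g) points points"
      using g filtermap_action_points filtermap_action_inv cauchy_carrier points_cauchy
      by (intro bij_betw_byWitness[where f' = "extended_action (inv g)"])
        (auto simp: extended_action_def)
    then show ?thesis by (simp add: Bij_def extended_action_def)
  qed
  have "extended_action (g \<otimes> h) = compose points (extended_action g) (extended_action h)"
    if gh: "g \<in> carrier G" "h \<in> carrier G" for g h
  proof
    fix F
    show "extended_action (g \<otimes> h) F = compose points (extended_action g) (extended_action h) F"
      using filtermap_action_mult[OF gh, of F] filtermap_action_points[OF gh(2), of F]
        cauchy_carrier[OF points_cauchy[of F]]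
      by (simp add: extended_action_def compose_def restrict_def)
  qed
  then show ?thesis
    using bij group group_BijGroup
    by (simp add: group_action_def group_hom_def group_hom_axioms_def hom_def BijGroup_def Pi_iff)
qed

text \<open>Let \<open>D\<close> belong to the translate \<open>gF\<close>. For \<open>h\<close> near \<open>g\<close> the element $h g^{-1}$ is in the neighbourhood
\<open>V\<close> given by boundedness of \<open>\<alpha>\<close>, so that \<open>hy\<close> and \<open>gy\<close> lie in a common member of \<open>\<alpha>\<close>. Hence \<open>h\<close> maps
the set \<open>E\<close> of all \<open>y\<close> with \<open>gy \<in> D\<close> into the \<open>\<alpha>\<close>-star of \<open>D\<close>, and \<open>E\<close> belongs to all filters near \<open>F\<close>.\<close>

lemma continuous_extended_action:
  "continuous_map (prod_topology TG hat) hat (\<lambda>(g, F). extended_action g F)"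
proof -
  have "continuous_map (prod_topology TG hat) hat
      (\<lambda>p. round_filter (median_uniformity X m) (filtermap (\<phi> (fst p)) (snd p)))"
  proof (rule continuous_map_round)
    fix p assume "p \<in> topspace (prod_topology TG hat)"
    then have p: "fst p \<in> carrier G" "snd p \<in> points"
      by (auto simp: topspace_TG topspace_hat)
    then show "cauchy (filtermap (\<phi> (fst p)) (snd p))"
      using filtermap_action_cauchy points_cauchy by blast
    fix D \<alpha> assume D: "D \<subseteq> X" "eventually (\<lambda>x. x \<in> D) (filtermap (\<phi> (fst p)) (snd p))"
      and \<alpha>: "\<alpha> \<in> median_uniformity X m"
    from bounded_neighbourhood[OF \<alpha>] obtain V where V: "openin TG V" "\<one> \<in> V"
      "\<forall>x\<in>X. \<exists>A\<in>\<alpha>. (\<lambda>g. \<phi> g x) ` V \<subseteq> A" by (elim exE conjE)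
    define g where "g = fst p"
    define F where "F = snd p"
    have g: "g \<in> carrier G" "inv g \<in> carrier G" using p group by (simp_all add: g_def)
    define N where "N = {h \<in> carrier G. h \<otimes> inv g \<in> V}"
    define E where "E = {y \<in> X. \<phi> g y \<in> D}"
    have "continuous_map TG (prod_topology TG TG) (\<lambda>h. (h, inv g))"
      using g(2) by (simp add: continuous_map_paired topspace_TG)
    then have "continuous_map TG TG ((\<lambda>(g, h). g \<otimes> h) \<circ> (\<lambda>h. (h, inv g)))"
      using topological_group unfolding topological_group_def
      by (intro continuous_map_compose[where X' = "prod_topology TG TG"]) auto
    then have "openin TG N"
      using V(1) unfolding N_def continuous_map_def topspace_TG by (simp add: o_def)
    then have "openin (prod_topology TG hat) (N \<times> extent E)"
      using openin_extent openin_prod_Times_iff by blast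
    moreover have "p \<in> N \<times> extent E"
    proof -
      have "g \<in> N" using g V(2) group by (simp add: N_def group.r_inv)
      moreover have "eventually (\<lambda>y. y \<in> E) F"
        using D(2) cauchy_carrier[OF points_cauchy[OF p(2)]] unfolding eventually_filtermap
        by (simp add: E_def F_def g_def eventually_conj)
      ultimately show ?thesis
        using p(2) by (cases p) (simp add: completion_extent_def g_def F_def)
    qed
    moreover have "eventually (\<lambda>x. x \<in> set_star D \<alpha>) (filtermap (\<phi> (fst q)) (snd q))"
      if q: "q \<in> N \<times> extent E" for q
    proof -
      have h: "fst q \<in> carrier G" "fst q \<otimes> inv g \<in> V" "eventually (\<lambda>y. y \<in> E) (snd q)"
        using q by (auto simp: N_def completion_extent_def)
      show ?thesis
        unfolding eventually_filtermap using h(3)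
      proof (rule eventually_mono)
        fix y assume "y \<in> E"
        then have y: "y \<in> X" "\<phi> g y \<in> D" by (auto simp: E_def)
        then have z: "\<phi> g y \<in> X" using D(1) by blast
        obtain A where A: "A \<in> \<alpha>" "(\<lambda>k. \<phi> k (\<phi> g y)) ` V \<subseteq> A" using V(3) z by blast
        have "\<phi> (fst q \<otimes> inv g) (\<phi> g y) \<in> A" "\<phi> \<one> (\<phi> g y) \<in> A"
          using A(2) h(2) V(2) by blast+
        moreover have "\<phi> (fst q \<otimes> inv g) (\<phi> g y) = \<phi> (fst q) y"
          using action_mult[OF h(1) g(2) z] action_inv(1)[OF g(1) y(1)] by simp
        moreover have "\<phi> \<one> (\<phi> g y) = \<phi> g y" using action_one[OF z] .
        ultimately show "\<phi> (fst q) y \<in> set_star D \<alpha>"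
          using A(1) y(2) unfolding set_star_def by auto
      qed
    qed
    ultimately show "\<exists>N. openin (prod_topology TG hat) N \<and> p \<in> N \<and>
        (\<forall>s\<in>N. eventually (\<lambda>x. x \<in> set_star D \<alpha>) (filtermap (\<phi> (fst s)) (snd s)))"
      by (intro exI[of _ "N \<times> extent E"] conjI ballI)
  qed
  then show ?thesis
    by (rule continuous_map_eq)
      (auto simp: topspace_TG topspace_hat extended_action_def round_point filtermap_action_points)
qed

lemma extended_action_\<iota>:
  assumes g: "g \<in> carrier G" and x: "x \<in> X"
  shows "extended_action g (\<iota> x) = \<iota> (\<phi> g x)"
proof -
  have F: "\<iota> x \<in> points" by (rule \<iota>_in_points[OF x])
  have "round_filter (median_uniformity X m) (filtermap (\<phi> g) (\<iota> x)) = \<iota> (\<phi> g x)"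
  proof (rule round_eq_\<iota>)
    show "cauchy (filtermap (\<phi> g) (\<iota> x))" by (rule filtermap_action_cauchy[OF g points_cauchy[OF F]])
    show "\<phi> g x \<in> X" by (rule action_closed[OF g x])
    fix A assume "eventually (\<lambda>x. x \<in> A) (filtermap (\<phi> g) (\<iota> x))"
    then show "\<phi> g x \<in> A" unfolding eventually_filtermap by (rule eventually_\<iota>_mem[OF x])
  qed
  then show ?thesis
    using F by (simp add: extended_action_def round_point filtermap_action_points g)
qed

end

section \<open>The median of the completion\<close>

context median_algebra
begin

definition extended_median :: "'a filter \<Rightarrow> 'a filter \<Rightarrow> 'a filter \<Rightarrow> 'a filter"
  where "extended_median F1 F2 F3 = round_filter (median_uniformity X m)
    (filtermap (\<lambda>(x, y, z). m x y z) (F1 \<times>\<^sub>F F2 \<times>\<^sub>F F3))"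

lemma eventually_median_filter:
  assumes "eventually (\<lambda>x. x \<in> A) F1" "eventually (\<lambda>x. x \<in> B) F2" "eventually (\<lambda>x. x \<in> C) F3"
    and "\<And>x y z. \<lbrakk>x \<in> A; y \<in> B; z \<in> C\<rbrakk> \<Longrightarrow> P (m x y z)"
  shows "eventually P (filtermap (\<lambda>(x, y, z). m x y z) (F1 \<times>\<^sub>F F2 \<times>\<^sub>F F3))"
proof -
  have "eventually (\<lambda>q. fst q \<in> B \<and> snd q \<in> C) (F2 \<times>\<^sub>F F3)"
    by (rule eventually_prodI[OF assms(2,3)])
  then have "eventually (\<lambda>p. fst p \<in> A \<and> fst (snd p) \<in> B \<and> snd (snd p) \<in> C) (F1 \<times>\<^sub>F F2 \<times>\<^sub>F F3)"
    by (rule eventually_prodI[OF assms(1)])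
  then show ?thesis
    unfolding eventually_filtermap by (rule eventually_mono) (auto intro: assms(4))
qed

lemma eventually_median_filterE:
  assumes "eventually P (filtermap (\<lambda>(x, y, z). m x y z) (F1 \<times>\<^sub>F F2 \<times>\<^sub>F F3))"
  obtains A B C where "eventually (\<lambda>x. x \<in> A) F1" "eventually (\<lambda>x. x \<in> B) F2"
    "eventually (\<lambda>x. x \<in> C) F3" "\<And>x y z. \<lbrakk>x \<in> A; y \<in> B; z \<in> C\<rbrakk> \<Longrightarrow> P (m x y z)"
proof -
  from assms obtain P1 Q where P1: "eventually P1 F1" and Q: "eventually Q (F2 \<times>\<^sub>F F3)"
    and 1: "\<And>x q. P1 x \<Longrightarrow> Q q \<Longrightarrow> P (case (x, q) of (x, y, z) \<Rightarrow> m x y z)"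
    unfolding eventually_filtermap eventually_prod_filter[of _ F1] by auto
  from Q obtain P2 P3 where 2: "eventually P2 F2" "eventually P3 F3"
    "\<And>y z. P2 y \<Longrightarrow> P3 z \<Longrightarrow> Q (y, z)"
    unfolding eventually_prod_filter by auto
  show ?thesis
    by (rule that[of "Collect P1" "Collect P2" "Collect P3"]) (use P1 1 2 in auto)
qed

text \<open>Of three Cauchy filters, two contain the same branch of the chain interval \<open>u\<close>, \<open>v\<close>, and medians of
points of which two are in a branch stay in that branch.\<close>

lemma median_filter_cauchy:
  assumes F: "cauchy F1" "cauchy F2" "cauchy F3"
  shows "cauchy (filtermap (\<lambda>(x, y, z). m x y z) (F1 \<times>\<^sub>F F2 \<times>\<^sub>F F3))" (is "cauchy ?H")
proof (rule cauchy_medianI)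
  show "?H \<noteq> bot"
    using F by (simp add: filtermap_bot_iff prod_filter_eq_bot cauchy_filter_on_def)
  note FX = cauchy_carrier[OF F(1)] cauchy_carrier[OF F(2)] cauchy_carrier[OF F(3)]
  show "eventually (\<lambda>x. x \<in> X) ?H"
    by (rule eventually_median_filter[OF FX]) (rule closed)
  fix u v assume uv: "chain_interval X m u v" "u \<noteq> v"
  have two: "eventually (\<lambda>x. x \<in> branch X m a b) ?H"
    if ab: "chain_interval X m a b" and
      ev: "eventually (\<lambda>x. x \<in> branch X m a b) F1 \<and> eventually (\<lambda>x. x \<in> branch X m a b) F2 \<or>
        eventually (\<lambda>x. x \<in> branch X m a b) F1 \<and> eventually (\<lambda>x. x \<in> branch X m a b) F3 \<or>
        eventually (\<lambda>x. x \<in> branch X m a b) F2 \<and> eventually (\<lambda>x. x \<in> branch X m a b) F3" for a b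
    using ev
  proof (elim disjE conjE)
    assume "eventually (\<lambda>x. x \<in> branch X m a b) F1" "eventually (\<lambda>x. x \<in> branch X m a b) F2"
    then show ?thesis
      using FX(3) by (rule eventually_median_filter) (rule branch_two_thirds(1)[OF ab])
  next
    assume 1: "eventually (\<lambda>x. x \<in> branch X m a b) F1" and 3: "eventually (\<lambda>x. x \<in> branch X m a b) F3"
    show ?thesis
      using 1 FX(2) 3 by (rule eventually_median_filter) (rule branch_two_thirds(2)[OF ab])
  next
    assume 2: "eventually (\<lambda>x. x \<in> branch X m a b) F2" and 3: "eventually (\<lambda>x. x \<in> branch X m a b) F3"
    show ?thesis
      using FX(1) 2 3 by (rule eventually_median_filter) (rule branch_two_thirds(3)[OF ab])
  qed
  show "eventually (\<lambda>x. x \<in> branch X m u v) ?H \<or> eventually (\<lambda>x. x \<in> branch X m v u) ?H"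
    using cauchy_branch[OF F(1) uv] cauchy_branch[OF F(2) uv] cauchy_branch[OF F(3) uv]
      two[OF uv(1)] two[OF chain_interval_commute[OF uv(1)]] by argo
qed

lemma continuous_extended_median: "continuous_ternary hat extended_median"
proof -
  let ?T = "prod_topology hat (prod_topology hat hat)"
  let ?H = "\<lambda>p. filtermap (\<lambda>(x, y, z). m x y z) (fst p \<times>\<^sub>F fst (snd p) \<times>\<^sub>F snd (snd p))"
  have "continuous_map ?T hat (\<lambda>p. round_filter (median_uniformity X m) (?H p))"
  proof (rule continuous_map_round)
    fix p assume "p \<in> topspace ?T"
    then have p: "fst p \<in> points" "fst (snd p) \<in> points" "snd (snd p) \<in> points"
      by (auto simp: topspace_hat)
    then show "cauchy (?H p)" by (intro median_filter_cauchy points_cauchy)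
    fix D \<alpha> assume D: "D \<subseteq> X" "eventually (\<lambda>x. x \<in> D) (?H p)" and \<alpha>: "\<alpha> \<in> median_uniformity X m"
    from D(2) obtain A B C where ABC: "eventually (\<lambda>x. x \<in> A) (fst p)" "eventually (\<lambda>x. x \<in> B) (fst (snd p))"
      "eventually (\<lambda>x. x \<in> C) (snd (snd p))" "\<And>x y z. \<lbrakk>x \<in> A; y \<in> B; z \<in> C\<rbrakk> \<Longrightarrow> m x y z \<in> D"
      by (rule eventually_median_filterE) blast
    let ?N = "extent A \<times> extent B \<times> extent C"
    have "openin ?T ?N" by (simp add: openin_prod_Times_iff openin_extent)
    moreover have "p \<in> ?N" using p ABC by (cases p) (auto simp: completion_extent_def)
    moreover have "eventually (\<lambda>x. x \<in> set_star D \<alpha>) (?H q)" if q: "q \<in> ?N" for q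
    proof (rule eventually_median_filter)
      show "eventually (\<lambda>x. x \<in> A) (fst q)" "eventually (\<lambda>x. x \<in> B) (fst (snd q))"
        "eventually (\<lambda>x. x \<in> C) (snd (snd q))" using q by (auto simp: completion_extent_def)
      show "m x y z \<in> set_star D \<alpha>" if "x \<in> A" "y \<in> B" "z \<in> C" for x y z
        using subset_set_star[OF \<alpha> D(1)] ABC(4)[OF that] by blast
    qed
    ultimately show "\<exists>N. openin ?T N \<and> p \<in> N \<and>
        (\<forall>q\<in>N. eventually (\<lambda>x. x \<in> set_star D \<alpha>) (?H q))"
      by (intro exI[of _ ?N] conjI ballI)
  qed
  then show ?thesis
    unfolding continuous_ternary_def
    by (rule continuous_map_eq) (auto simp: extended_median_def)
qed

lemma extended_median_\<iota>: "median_preserving X m extended_median \<iota>"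
  unfolding median_preserving_def
proof (intro ballI)
  fix x y z assume X: "x \<in> X" "y \<in> X" "z \<in> X"
  show "\<iota> (m x y z) = extended_median (\<iota> x) (\<iota> y) (\<iota> z)"
    unfolding extended_median_def
  proof (rule round_eq_\<iota>[symmetric])
    show "cauchy (filtermap (\<lambda>(x, y, z). m x y z) (\<iota> x \<times>\<^sub>F \<iota> y \<times>\<^sub>F \<iota> z))"
      using X by (intro median_filter_cauchy points_cauchy \<iota>_in_points)
    show "m x y z \<in> X" using X by (rule closed)
    fix A assume "eventually (\<lambda>x. x \<in> A) (filtermap (\<lambda>(x, y, z). m x y z) (\<iota> x \<times>\<^sub>F \<iota> y \<times>\<^sub>F \<iota> z))"
    then show "m x y z \<in> A"
      by (rule eventually_median_filterE) (use X eventually_\<iota>_mem in blast)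
  qed
qed

text \<open>The chosen median is only known to be one of the continuous extensions; \<open>extended_median\<close> shows that
there is one to choose.\<close>

lemma mmc_median_properties:
  "continuous_ternary hat (mmc_median X m)" "median_preserving X m (mmc_median X m) \<iota>"
proof -
  have "continuous_ternary hat (mmc_median X m) \<and> median_preserving X m (mmc_median X m) \<iota>"
    unfolding mmc_median_def mmc_topology_def mmc_map_def
    by (rule someI[of _ extended_median]) (use continuous_extended_median extended_median_\<iota> in blast)
  then show "continuous_ternary hat (mmc_median X m)" "median_preserving X m (mmc_median X m) \<iota>"
    by auto
qed

end

section \<open>The compactification\<close>

context median_algebra
begin

text \<open>Two points separated by a chain interval are separated by the open set $B^u_v$, so that their
neighbourhood filters differ.\<close>

lemma inj_\<iota>:
  assumes T2: "median_T2 X m"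
  shows "inj_on \<iota> X"
proof (rule inj_onI, rule ccontr)
  fix x y assume X: "x \<in> X" "y \<in> X" and eq: "\<iota> x = \<iota> y" and "x \<noteq> y"
  then obtain u v where uv: "chain_interval X m u v" "u \<noteq> v" "{m u x v, m u y v} = {u, v}"
    using T2 unfolding median_T2_def retraction_def by blast
  have one: False
    if ab: "a \<in> X" "b \<in> X" "\<iota> a = \<iota> b" "m u a v = u" "m u b v = v" for a b
  proof -
    have "a \<in> branch X m u v" "b \<notin> branch X m u v" using ab uv(2) by (auto simp: branch_def)
    moreover have "eventually (\<lambda>x. x \<in> branch X m u v) (\<iota> a)"
      using openin_branch[OF uv(1)] calculation(1)
      unfolding completion_map_def eventually_nhdsin median_topology_def by blast
    ultimately have "eventually (\<lambda>x. x \<in> branch X m u v) (\<iota> b)" using ab(3) by simp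
    then show False using eventually_\<iota>_mem[OF ab(2)] \<open>b \<notin> _\<close> by blast
  qed
  from uv(3) have "m u x v = u \<and> m u y v = v \<or> m u x v = v \<and> m u y v = u"
    by (auto simp: doubleton_eq_iff)
  then show False using one[of x y] one[of y x] X eq by auto
qed

lemma ultrafilter_cauchy:
  assumes H: "H \<noteq> bot" "H \<le> principal X" "\<And>P. eventually P H \<or> eventually (\<lambda>x. \<not> P x) H"
  shows "cauchy H"
proof (rule cauchy_medianI[OF H(1)])
  show HX: "eventually (\<lambda>x. x \<in> X) H" using H(2) by (simp add: le_principal)
  fix u v assume uv: "chain_interval X m u v" "u \<noteq> v"
  have "eventually (\<lambda>x. x \<in> branch X m v u) H" if "eventually (\<lambda>x. x \<notin> branch X m u v) H"
    using HX that by eventually_elim (use branch_cover[OF chain_intervalD[OF uv(1)] uv(2)] in blast)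
  then show "eventually (\<lambda>x. x \<in> branch X m u v) H \<or> eventually (\<lambda>x. x \<in> branch X m v u) H"
    using H(3)[of "\<lambda>x. x \<in> branch X m u v"] by blast
qed

abbreviation "hat4 \<equiv> prod_topology hat (prod_topology hat (prod_topology hat hat))"

lemma continuous_projections:
  "continuous_map hat4 hat fst"
  "continuous_map hat4 hat (\<lambda>p. fst (snd p))"
  "continuous_map hat4 hat (\<lambda>p. fst (snd (snd p)))"
  "continuous_map hat4 hat (\<lambda>p. snd (snd (snd p)))"
proof -
  have 1: "continuous_map hat4 (prod_topology hat (prod_topology hat hat)) snd"
    by (rule continuous_map_snd)
  have 2: "continuous_map hat4 (prod_topology hat hat) (\<lambda>p. snd (snd p))"
    using continuous_map_snd_of[OF 1] by (simp add: o_def)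
  show "continuous_map hat4 hat fst" by (rule continuous_map_fst)
  show "continuous_map hat4 hat (\<lambda>p. fst (snd p))"
    using continuous_map_fst_of[OF 1] by (simp add: o_def)
  show "continuous_map hat4 hat (\<lambda>p. fst (snd (snd p)))"
    using continuous_map_fst_of[OF 2] by (simp add: o_def)
  show "continuous_map hat4 hat (\<lambda>p. snd (snd (snd p)))"
    using continuous_map_snd_of[OF 2] by (simp add: o_def)
qed

text \<open>The fourth power of the completion serves for all identities below, the longest of which is the
associative law of the median.\<close>

lemma identity_by_density:
  assumes f: "continuous_map hat4 hat (\<lambda>p. f (fst p) (fst (snd p)) (fst (snd (snd p))) (snd (snd (snd p))))"
    and g: "continuous_map hat4 hat (\<lambda>p. g (fst p) (fst (snd p)) (fst (snd (snd p))) (snd (snd (snd p))))"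
    and eq: "\<And>a b c d. \<lbrakk>a \<in> X; b \<in> X; c \<in> X; d \<in> X\<rbrakk> \<Longrightarrow>
      f (\<iota> a) (\<iota> b) (\<iota> c) (\<iota> d) = g (\<iota> a) (\<iota> b) (\<iota> c) (\<iota> d)"
    and F: "F1 \<in> points" "F2 \<in> points" "F3 \<in> points" "F4 \<in> points"
  shows "f F1 F2 F3 F4 = g F1 F2 F3 F4"
proof -
  let ?S = "\<iota> ` X"
  have "Abstract_Topology.closure_of hat4 (?S \<times> ?S \<times> ?S \<times> ?S) = points \<times> points \<times> points \<times> points"
    by (simp add: closure_of_Times dense_\<iota>)
  then have "(F1, F2, F3, F4) \<in> Abstract_Topology.closure_of hat4 (?S \<times> ?S \<times> ?S \<times> ?S)"
    using F by simp
  moreover have "f (fst p) (fst (snd p)) (fst (snd (snd p))) (snd (snd (snd p))) =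
      g (fst p) (fst (snd p)) (fst (snd (snd p))) (snd (snd (snd p)))"
    if "p \<in> ?S \<times> ?S \<times> ?S \<times> ?S" for p
    using that eq by auto
  ultimately show ?thesis
    using forall_in_closure_of_eq[OF _ Hausdorff_hat f g, of "(F1, F2, F3, F4)"] by simp
qed

abbreviation "M \<equiv> mmc_median X m"

lemma continuous_M:
  assumes "continuous_map T hat f" "continuous_map T hat g" "continuous_map T hat h"
  shows "continuous_map T hat (\<lambda>p. M (f p) (g p) (h p))"
proof -
  have "continuous_map T (prod_topology hat (prod_topology hat hat)) (\<lambda>p. (f p, g p, h p))"
    using assms by (simp add: continuous_map_paired)
  then have "continuous_map T hat ((\<lambda>(x, y, z). M x y z) \<circ> (\<lambda>p. (f p, g p, h p)))"
    using mmc_median_properties(1) unfolding continuous_ternary_def by (rule continuous_map_compose)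
  then show ?thesis by (simp add: o_def)
qed

lemma M_\<iota>: "\<lbrakk>x \<in> X; y \<in> X; z \<in> X\<rbrakk> \<Longrightarrow> M (\<iota> x) (\<iota> y) (\<iota> z) = \<iota> (m x y z)"
  using mmc_median_properties(2) by (simp add: median_preserving_def)

lemma topological_median_algebra_hat: "topological_median_algebra hat M"
  unfolding topological_median_algebra_def topspace_hat
proof (intro conjI)
  show "continuous_ternary hat M" by (rule mmc_median_properties(1))
  show "median_algebra points M"
  proof
    fix F1 F2 F3 assume F: "F1 \<in> points" "F2 \<in> points" "F3 \<in> points"
    show "M F1 F2 F3 \<in> points"
      using continuous_map_funspace[OF mmc_median_properties(1)[unfolded continuous_ternary_def]] F
      by (auto simp: topspace_hat dest!: funcset_mem[where x = "(F1, F2, F3)"])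
    show "M F1 F2 F3 = M F2 F1 F3"
      by (rule identity_by_density[where f = "\<lambda>a b c d. M a b c" and g = "\<lambda>a b c d. M b a c", OF _ _ _ F F(1)])
        (intro continuous_M continuous_projections | simp add: M_\<iota> sym12)+
    show "M F1 F2 F3 = M F1 F3 F2"
      by (rule identity_by_density[where f = "\<lambda>a b c d. M a b c" and g = "\<lambda>a b c d. M a c b", OF _ _ _ F F(1)])
        (intro continuous_M continuous_projections | simp add: M_\<iota> sym23)+
  next
    fix F1 F2 assume F: "F1 \<in> points" "F2 \<in> points"
    show "M F1 F2 F2 = F2"
      by (rule identity_by_density[where f = "\<lambda>a b c d. M a b b" and g = "\<lambda>a b c d. b", OF _ _ _ F F])
        (intro continuous_M continuous_projections | simp add: M_\<iota> majority)+
  next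
    fix F1 F2 F3 F4 assume F: "F1 \<in> points" "F2 \<in> points" "F3 \<in> points" "F4 \<in> points"
    show "M (M F1 F4 F2) F4 F3 = M F1 F4 (M F2 F4 F3)"
      by (rule identity_by_density[where f = "\<lambda>a b c d. M (M a d b) d c"
            and g = "\<lambda>a b c d. M a d (M b d c)", OF _ _ _ F])
        (intro continuous_M continuous_projections | simp add: M_\<iota> closed assoc)+
  qed
qed

end

lemma embedding_map_reflects_continuity:
  assumes f: "embedding_map T T' f"
    and fh: "continuous_map S T' (\<lambda>x. f (h x))" and h: "h \<in> topspace S \<rightarrow> topspace T"
  shows "continuous_map S T h"
proof -
  obtain k where k: "homeomorphic_maps T (subtopology T' (f ` topspace T)) f k"
    using f unfolding embedding_map_def homeomorphic_map_maps by blast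
  have "continuous_map S (subtopology T' (f ` topspace T)) (\<lambda>x. f (h x))"
    using fh h by (auto simp: continuous_map_in_subtopology)
  then have "continuous_map S T (k \<circ> (\<lambda>x. f (h x)))"
    using k unfolding homeomorphic_maps_def by (blast intro: continuous_map_compose)
  then show ?thesis
    by (rule continuous_map_eq) (use k h in \<open>auto simp: homeomorphic_maps_def\<close>)
qed

context median_action
begin

lemma continuous_action_section:
  assumes \<psi>: "continuous_map (prod_topology TG hat) hat (\<lambda>(g, F). \<psi> g F)" and g: "g \<in> carrier G"
  shows "continuous_map hat hat (\<psi> g)"
proof -
  have "continuous_map hat (prod_topology TG hat) (\<lambda>F. (g, F))"
    using g by (simp add: continuous_map_paired topspace_TG)
  from continuous_map_compose[OF this \<psi>] show ?thesis by (simp add: o_def)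
qed

lemma extended_action_median:
  assumes g: "g \<in> carrier G" and F: "F1 \<in> points" "F2 \<in> points" "F3 \<in> points"
  shows "extended_action g (M F1 F2 F3) = M (extended_action g F1) (extended_action g F2) (extended_action g F3)"
proof -
  have c: "continuous_map T hat (\<lambda>p. extended_action g (f p))" if "continuous_map T hat f" for T f
    using continuous_map_compose[OF that continuous_action_section[OF continuous_extended_action g]]
    by (simp add: o_def)
  show ?thesis
    by (rule identity_by_density[where f = "\<lambda>a b c d. extended_action g (M a b c)"
          and g = "\<lambda>a b c d. M (extended_action g a) (extended_action g b) (extended_action g c)",
          OF _ _ _ F F(1)])
      (intro continuous_M c continuous_projections |
        simp add: M_\<iota> closed action_closed extended_action_\<iota> action_median g)+
qed

lemma extended_action_unique:
  assumes \<psi>: "continuous_map (prod_topology TG hat) hat (\<lambda>(g, F). \<psi> g F)"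
    and equi: "equivariant G X \<phi> \<psi> \<iota>" and g: "g \<in> carrier G" and F: "F \<in> points"
  shows "\<psi> g F = extended_action g F"
proof (rule forall_in_closure_of_eq[OF _ Hausdorff_hat continuous_action_section[OF \<psi> g]
      continuous_action_section[OF continuous_extended_action g]])
  show "F \<in> Abstract_Topology.closure_of hat (\<iota> ` X)" using F dense_\<iota> by simp
  fix K assume "K \<in> \<iota> ` X"
  then show "\<psi> g K = extended_action g K"
    using equi g extended_action_\<iota> unfolding equivariant_def by auto
qed

lemma equivariant_\<iota>: "equivariant G X \<phi> extended_action \<iota>"
  using extended_action_\<iota> by (simp add: equivariant_def)

lemma jointly_continuous_extended: "jointly_continuous_action G TG hat extended_action"
  unfolding jointly_continuous_action_def topspace_hat
  using group_action_extended continuous_extended_action by simp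

lemma compactification:
  assumes T2: "median_T2 X m"
  shows "proper_median_G_compactification G TG \<tau> m \<phi> hat M extended_action \<iota>"
  unfolding proper_median_G_compactification_def topspace_\<tau> topspace_hat
proof (intro conjI)
  show "compact_space hat" by (rule compact_hat) (rule ultrafilter_cauchy)
  show "Hausdorff_space hat" by (rule Hausdorff_hat)
  show "topological_median_algebra hat M" by (rule topological_median_algebra_hat)
  show "jointly_continuous_action G TG hat extended_action" by (rule jointly_continuous_extended)
  show "acts_by_median_automorphisms G points M extended_action"
    unfolding acts_by_median_automorphisms_def median_preserving_def
    using group_action_extended extended_action_median by blast
  show "embedding_map \<tau> hat \<iota>" by (rule embedding_\<iota>[OF inj_\<iota>[OF T2]])
  show "Abstract_Topology.closure_of hat (\<iota> ` X) = points" by (rule dense_\<iota>)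
  show "median_preserving X m M \<iota>" by (rule mmc_median_properties(2))
  show "equivariant G X \<phi> extended_action \<iota>" by (rule equivariant_\<iota>)
qed

lemma jointly_continuous_action_T2:
  assumes T2: "median_T2 X m"
  shows "jointly_continuous_action G TG \<tau> \<phi>"
  unfolding jointly_continuous_action_def topspace_\<tau>
proof (intro conjI group_action)
  have fst_snd: "fst p \<in> carrier G \<and> snd p \<in> X" if "p \<in> topspace (prod_topology TG \<tau>)" for p
    using that by (auto simp: topspace_TG topspace_\<tau>)
  have "continuous_map \<tau> hat \<iota>"
    by (rule continuous_\<iota>)
  then have "continuous_map (prod_topology TG \<tau>) hat (\<lambda>p. \<iota> (snd p))"
    using continuous_map_compose[OF continuous_map_snd] by (fastforce simp: o_def)
  then have "continuous_map (prod_topology TG \<tau>) (prod_topology TG hat) (\<lambda>p. (fst p, \<iota> (snd p)))"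
    by (intro continuous_map_pairedI continuous_map_fst)
  from continuous_map_compose[OF this continuous_extended_action]
  have "continuous_map (prod_topology TG \<tau>) hat (\<lambda>p. extended_action (fst p) (\<iota> (snd p)))"
    by (simp add: o_def)
  then have "continuous_map (prod_topology TG \<tau>) hat (\<lambda>p. \<iota> (\<phi> (fst p) (snd p)))"
    by (rule continuous_map_eq) (use fst_snd extended_action_\<iota> in blast)
  then have "continuous_map (prod_topology TG \<tau>) \<tau> (\<lambda>p. \<phi> (fst p) (snd p))"
    by (rule embedding_map_reflects_continuity[OF embedding_\<iota>[OF inj_\<iota>[OF T2]]])
      (use fst_snd action_closed in \<open>auto simp: topspace_\<tau>\<close>)
  then show "continuous_map (prod_topology TG \<tau>) \<tau> (\<lambda>(g, x). \<phi> g x)"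
    by (simp add: case_prod_beta')
qed

end

theorem theorem7p1:
  fixes X :: "'a set" and m :: "'a \<Rightarrow> 'a \<Rightarrow> 'a \<Rightarrow> 'a"
    and G :: "('g, 'r) monoid_scheme" and TG :: "'g topology"
    and \<phi> :: "'g \<Rightarrow> 'a \<Rightarrow> 'a"
  assumes "median_algebra X m"
    and "topological_group G TG"
    and "separately_continuous_action G TG (median_topology X m) \<phi>"
    and "acts_by_median_automorphisms G X m \<phi>"
  shows "G_bounded G TG X \<phi> (median_uniformity X m) \<and>
    (median_T2 X m \<longrightarrow>
      (\<exists>\<psi>. jointly_continuous_action G TG (mmc_topology X m) \<psi> \<and>
           equivariant G X \<phi> \<psi> (mmc_map X m) \<and>
           (\<forall>\<psi>'. jointly_continuous_action G TG (mmc_topology X m) \<psi>' \<and>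
                 equivariant G X \<phi> \<psi>' (mmc_map X m) \<longrightarrow>
                 (\<forall>g\<in>carrier G. \<forall>\<xi>\<in>mmc X m. \<psi>' g \<xi> = \<psi> g \<xi>)) \<and>
           proper_median_G_compactification G TG
             (median_topology X m) m \<phi>
             (mmc_topology X m) (mmc_median X m) \<psi> (mmc_map X m)) \<and>
      jointly_continuous_action G TG (median_topology X m) \<phi>)"
proof -
  interpret median_action X m G TG \<phi>
    using assms by (simp add: median_action_def median_action_axioms_def)
  show ?thesis
    unfolding mmc_topology_def mmc_map_def mmc_def median_topology_def
  proof (intro conjI impI)
    show "G_bounded G TG X \<phi> (median_uniformity X m)" by (rule G_bounded_median_uniformity)
    assume T2: "median_T2 X m"
    show "jointly_continuous_action G TG \<tau> \<phi>" by (rule jointly_continuous_action_T2[OF T2])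
    show "\<exists>\<psi>. jointly_continuous_action G TG hat \<psi> \<and> equivariant G X \<phi> \<psi> \<iota> \<and>
        (\<forall>\<psi>'. jointly_continuous_action G TG hat \<psi>' \<and> equivariant G X \<phi> \<psi>' \<iota> \<longrightarrow>
          (\<forall>g\<in>carrier G. \<forall>\<xi>\<in>points. \<psi>' g \<xi> = \<psi> g \<xi>)) \<and>
        proper_median_G_compactification G TG \<tau> m \<phi> hat M \<psi> \<iota>"
    proof (intro exI[of _ extended_action] conjI allI impI ballI)
      fix \<psi>' g \<xi>
      assume "jointly_continuous_action G TG hat \<psi>' \<and> equivariant G X \<phi> \<psi>' \<iota>"
        and "g \<in> carrier G" "\<xi> \<in> points"
      then show "\<psi>' g \<xi> = extended_action g \<xi>"
        using extended_action_unique unfolding jointly_continuous_action_def by blast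
    qed (rule jointly_continuous_extended equivariant_\<iota> compactification[OF T2])+
  qed
qed

end
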